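(* Let $H$ be a separable infinite-dimensional complex Hilbert space with orthonormal basis $E=(e_n)_{n\in\mathbb{N}}$. Then, with respect to the weak operator topology, the set of exposed points of the doubly substochastic matrices is the set of partial permutation matrices, and the set of exposed points of the doubly stochastic matrices is the set of permutation matrices: $\mathrm{exp}_w(\mathrm{DSS})=\mathrm{PS}_{\mathbb{N}}$ and $\mathrm{exp}_w(\mathrm{DS})=\pi(\mathrm{S}_{\mathbb{N}})$.
   Context: For $a\in B(H)$ write $a_{mk}=\langle ae_k,e_m\rangle$. $\mathrm{S}_{\mathbb{N}}$ is the group of all bijections $\mathbb{N}\to\mathbb{N}$, and $\pi:\mathrm{S}_{\mathbb{N}}\to B(H)$ is given by $\pi(\rho)e_n=e_{\rho(n)}$. $\mathrm{DS}=\{a\in B(H): a_{mk}\ge 0,\ \sum_{k=1}^\infty a_{mk}=\sum_{k=1}^\infty a_{km}=1\text{ for all } m,k\}$. $\mathrm{DSS}=\{a\in B(H): a_{mk}\ge 0,\ \sum_{k=1}^\infty a_{mk}\le 1,\ \sum_{k=1}^\infty a_{km}\le 1 \text{ for all } m,k\}$. $\mathrm{PS}_{\mathbb{N}}=\{a\in B(H): a_{mk}\in\{0,1\},\ \sum_k a_{mk}\le 1,\ \sum_k a_{km}\le 1\text{ for all } m,k\}$. For a convex set $C\subseteq B(H)$, $\mathrm{exp}_w(C)$ is the set of $u\in C$ for which there is a weak-operator-continuous linear functional $f$ on $B(H)$ such that $\mathrm{Re} f(v)<\mathrm{Re} f(u)$ for all $v\in C\setminus\{u\}$. *)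

theory Defs
  imports "HOL-Analysis.Analysis" "HOL-Library.Complex_Order"
begin

text \<open>Complex Hilbert spaces. The inner product is linear in its first argument, so that the
  matrix entry \<open>cinner (a (e k)) (e m)\<close> below depends linearly on \<open>a\<close>.\<close>

class complex_hilbert = banach +
  fixes scaleC :: "complex \<Rightarrow> 'a \<Rightarrow> 'a"  (infixr "*\<^sub>C" 75)
    and cinner :: "'a \<Rightarrow> 'a \<Rightarrow> complex"
  assumes scaleC_add_right: "c *\<^sub>C (x + y) = c *\<^sub>C x + c *\<^sub>C y"
    and scaleC_add_left: "(c + d) *\<^sub>C x = c *\<^sub>C x + d *\<^sub>C x"
    and scaleC_scaleC: "c *\<^sub>C d *\<^sub>C x = (c * d) *\<^sub>C x"
    and scaleC_of_real: "complex_of_real r *\<^sub>C x = r *\<^sub>R x"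
    and cinner_commute: "cinner x y = cnj (cinner y x)"
    and cinner_add_left: "cinner (x + y) z = cinner x z + cinner y z"
    and cinner_scaleC_left: "cinner (c *\<^sub>C x) y = c * cinner x y"
    and cinner_ge_zero: "0 \<le> cinner x x"
    and cinner_eq_zero_iff: "cinner x x = 0 \<longleftrightarrow> x = 0"
    and norm_eq_sqrt_cinner: "norm x = sqrt (Re (cinner x x))"

lemma scaleC_one [simp]: "1 *\<^sub>C x = (x :: 'a::complex_hilbert)"
  using scaleC_of_real[of 1 x] by simp

global_interpretation complex_vector: vector_space "scaleC :: complex \<Rightarrow> 'a \<Rightarrow> 'a::complex_hilbert"
  defines cspan = complex_vector.span
  by unfold_locales (simp_all add: scaleC_add_right scaleC_add_left scaleC_scaleC)

text \<open>As the index set is \<open>nat\<close>, a space with such a basis is separable and infinite-dimensional.\<close>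

definition orthonormal_basis :: "(nat \<Rightarrow> 'a::complex_hilbert) \<Rightarrow> bool" where
  "orthonormal_basis e \<longleftrightarrow>
     (\<forall>m n. cinner (e m) (e n) = (if m = n then 1 else 0)) \<and> closure (cspan (range e)) = UNIV"

text \<open>\<open>B(H)\<close> as a carrier set of functions, with the pointwise vector space operations.\<close>

definition bounded_ops :: "('a::complex_hilbert \<Rightarrow> 'a) set" where
  "bounded_ops = {a. bounded_linear a \<and> (\<forall>c x. a (c *\<^sub>C x) = c *\<^sub>C a x)}"

text \<open>The coarsest topology on \<open>B(H)\<close> making all \<open>a \<mapsto> cinner (a x) y\<close> continuous
  (\<open>euclidean\<close> on the function type is the product topology).\<close>

definition weak_operator_topology :: "('a::complex_hilbert \<Rightarrow> 'a) topology" where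
  "weak_operator_topology = pullback_topology bounded_ops (\<lambda>a x y. cinner (a x) y) euclidean"

text \<open>Only the values of \<open>f\<close> on \<open>bounded_ops\<close> matter here.\<close>

definition wot_functional :: "(('a::complex_hilbert \<Rightarrow> 'a) \<Rightarrow> complex) \<Rightarrow> bool" where
  "wot_functional f \<longleftrightarrow>
     (\<forall>a\<in>bounded_ops. \<forall>b\<in>bounded_ops. f (\<lambda>x. a x + b x) = f a + f b) \<and>
     (\<forall>c. \<forall>a\<in>bounded_ops. f (\<lambda>x. c *\<^sub>C a x) = c * f a) \<and>
     continuous_map weak_operator_topology euclidean f"

definition wot_exposed :: "('a::complex_hilbert \<Rightarrow> 'a) set \<Rightarrow> ('a \<Rightarrow> 'a) set" where
  "wot_exposed C =
     {u \<in> C. \<exists>f. wot_functional f \<and> (\<forall>v \<in> C - {u}. Re (f v) < Re (f u))}"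

definition entry :: "(nat \<Rightarrow> 'a::complex_hilbert) \<Rightarrow> ('a \<Rightarrow> 'a) \<Rightarrow> nat \<Rightarrow> nat \<Rightarrow> complex" where
  "entry e a m k = cinner (a (e k)) (e m)"

text \<open>The order on \<open>complex\<close> is the one with \<open>z \<le> w\<close> iff \<open>w - z\<close> is a nonnegative real.
  Summability is required explicitly because \<open>suminf\<close> has a junk value on divergent series.\<close>

definition doubly_stochastic :: "(nat \<Rightarrow> 'a::complex_hilbert) \<Rightarrow> ('a \<Rightarrow> 'a) set" where
  "doubly_stochastic e = {a \<in> bounded_ops.
     (\<forall>m k. 0 \<le> entry e a m k) \<and>
     (\<forall>m. (\<lambda>k. entry e a m k) sums 1) \<and> (\<forall>m. (\<lambda>k. entry e a k m) sums 1)}"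

definition doubly_substochastic :: "(nat \<Rightarrow> 'a::complex_hilbert) \<Rightarrow> ('a \<Rightarrow> 'a) set" where
  "doubly_substochastic e = {a \<in> bounded_ops.
     (\<forall>m k. 0 \<le> entry e a m k) \<and>
     (\<forall>m. summable (\<lambda>k. entry e a m k) \<and> (\<Sum>k. entry e a m k) \<le> 1) \<and>
     (\<forall>m. summable (\<lambda>k. entry e a k m) \<and> (\<Sum>k. entry e a k m) \<le> 1)}"

definition partial_permutations :: "(nat \<Rightarrow> 'a::complex_hilbert) \<Rightarrow> ('a \<Rightarrow> 'a) set" where
  "partial_permutations e = {a \<in> bounded_ops.
     (\<forall>m k. entry e a m k \<in> {0, 1}) \<and>
     (\<forall>m. summable (\<lambda>k. entry e a m k) \<and> (\<Sum>k. entry e a m k) \<le> 1) \<and>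
     (\<forall>m. summable (\<lambda>k. entry e a k m) \<and> (\<Sum>k. entry e a k m) \<le> 1)}"

definition perm_op :: "(nat \<Rightarrow> 'a::complex_hilbert) \<Rightarrow> (nat \<Rightarrow> nat) \<Rightarrow> 'a \<Rightarrow> 'a" where
  "perm_op e \<rho> = (THE a. a \<in> bounded_ops \<and> (\<forall>n. a (e n) = e (\<rho> n)))"

end

theory Submission
  imports Defs
begin

text \<open>
  Exposed points are extreme, so it suffices for one inclusion to write a matrix with an entry in
  \<open>(0, 1)\<close> as a proper midpoint. Regard rows and columns as the vertices of a bipartite
  graph with the entries as edge weights. A perturbation preserving row and column sums is a
  circulation dominated by the weights. If the support contains a cycle, take a small
  multiple of the cycle. Otherwise the component of the fractional edge is a tree; push flow through
  that edge and split it at every vertex in proportion to the remaining weights. The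
  ratio of flow to weight is multiplied by \<open>q / (1 - q)\<close> when crossing an edge of weight
  \<open>q\<close>, and two consecutive such factors have product at most 1 because adjacent weights add up to
  at most 1; so the ratio stays bounded and a multiple of the flow is dominated by the weights.

  Conversely, let \<open>u\<close> be a partial permutation matrix with column support \<open>K\<close> and row
  support \<open>M\<close>, and let \<open>t\<close> be positive, summable and injective. Take the functional whose
  coefficient at the row matched to column \<open>k'\<close> and column \<open>k\<close> is \<open>t k * t k'\<close>, with negative
  coefficients outside \<open>M \<times> K\<close>; a difference of two rank-one functionals has this shape.
  Since \<open>t k * t k' \<le> (t k)\<^sup>2 / 2 + (t k')\<^sup>2 / 2\<close> with equality only for \<open>k = k'\<close>, summing
  against a doubly substochastic matrix shows that \<open>u\<close> is the only maximiser.
\<close>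

section \<open>Hilbert space preliminaries\<close>

lemma cinner_add_right: "cinner x (y + z) = cinner x y + cinner (x :: 'a::complex_hilbert) z"
  by (metis cinner_add_left cinner_commute complex_cnj_add)

lemma cinner_scaleC_right: "cinner x (c *\<^sub>C y) = cnj c * cinner (x :: 'a::complex_hilbert) y"
  by (metis cinner_commute cinner_scaleC_left complex_cnj_mult)

lemma cinner_scaleR_left: "cinner (r *\<^sub>R x) y = r *\<^sub>R cinner (x :: 'a::complex_hilbert) y"
  using cinner_scaleC_left[of "complex_of_real r" x y]
  by (simp add: scaleC_of_real scaleR_conv_of_real)

lemma cinner_zero_left [simp]: "cinner 0 (y :: 'a::complex_hilbert) = 0"
  using cinner_add_left[of 0 0 y] by simp

lemma cinner_zero_right [simp]: "cinner (y :: 'a::complex_hilbert) 0 = 0"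
  using cinner_commute[of y 0] by simp

lemma cinner_minus_left: "cinner (- x) y = - cinner (x :: 'a::complex_hilbert) y"
  using cinner_add_left[of x "- x" y] by (simp add: add_eq_0_iff2 add.commute)

lemma cinner_minus_right: "cinner x (- y) = - cinner (x :: 'a::complex_hilbert) y"
  by (metis cinner_commute cinner_minus_left complex_cnj_minus)

lemma cinner_diff_left: "cinner (x - y) z = cinner x z - cinner (y :: 'a::complex_hilbert) z"
  using cinner_add_left[of x "- y" z] by (simp add: cinner_minus_left)

lemma cinner_diff_right: "cinner x (y - z) = cinner x y - cinner (x :: 'a::complex_hilbert) z"
  using cinner_add_right[of x y "- z"] by (simp add: cinner_minus_right)

lemma cinner_sum_left:
  "cinner (\<Sum>i\<in>I. f i) y = (\<Sum>i\<in>I. cinner (f i) (y :: 'a::complex_hilbert))"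
  by (induction I rule: infinite_finite_induct) (simp_all add: cinner_add_left)

lemma cinner_self: "cinner x x = complex_of_real ((norm (x :: 'a::complex_hilbert))\<^sup>2)"
  using cinner_ge_zero[of x] norm_eq_sqrt_cinner[of x]
  by (simp add: complex_eq_iff less_eq_complex_def)

text \<open>Cauchy-Schwarz: subtracting from \<open>x\<close> its projection
  \<open>c *\<^sub>C y\<close> leaves a vector whose squared norm is \<open>(norm x)\<^sup>2 - (cmod
  (cinner x y))\<^sup>2 / (norm y)\<^sup>2\<close>, and this is nonnegative.\<close>

lemma cmod_cinner_le: "cmod (cinner x y) \<le> norm (x :: 'a::complex_hilbert) * norm y"
proof (cases "y = 0")
  case False
  define c where "c = cinner x y / cinner y y"
  have y: "norm y > 0" using False by simp
  have yy: "cinner y y = complex_of_real ((norm y)\<^sup>2)" by (rule cinner_self)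
  have "cinner (x - c *\<^sub>C y) (x - c *\<^sub>C y) = cinner x x - c * cinner y x"
  proof -
    have "c * cinner y y = cinner x y"
      using y unfolding c_def yy by simp
    then have "c * (cnj c * cinner y y) = cnj c * cinner x y"
      by (simp add: mult.left_commute)
    then show ?thesis
      by (simp add: cinner_diff_left cinner_diff_right cinner_scaleC_left cinner_scaleC_right
          algebra_simps)
  qed
  also have "c * cinner y x = complex_of_real ((cmod (cinner x y))\<^sup>2 / (norm y)\<^sup>2)"
    unfolding c_def yy by (subst cinner_commute[of y x]) (simp add: complex_norm_square del: of_real_power)
  finally have "Re (complex_of_real ((norm (x - c *\<^sub>C y))\<^sup>2))
      = Re (complex_of_real ((norm x)\<^sup>2 - (cmod (cinner x y))\<^sup>2 / (norm y)\<^sup>2))"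
    unfolding cinner_self by simp
  then have "0 \<le> (norm x)\<^sup>2 - (cmod (cinner x y))\<^sup>2 / (norm y)\<^sup>2"
    by (metis Re_complex_of_real zero_le_power2)
  then have "(cmod (cinner x y))\<^sup>2 \<le> (norm x * norm y)\<^sup>2"
    using y by (simp add: field_simps)
  then show ?thesis
    by (simp add: power2_le_iff_abs_le)
qed simp

lemma bounded_linear_cinner_left: "bounded_linear (\<lambda>x. cinner x (y :: 'a::complex_hilbert))"
  by (rule bounded_linear_intro[where K = "norm y"])
     (auto simp: cinner_add_left cinner_scaleR_left cmod_cinner_le)

lemma bounded_linear_cinner_right: "bounded_linear (\<lambda>y. cinner (x :: 'a::complex_hilbert) y)"
  by (rule bounded_linear_intro[where K = "norm x"])
     (auto simp: cinner_add_right cmod_cinner_le mult.commute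
        cinner_commute[of x] cinner_scaleR_left scaleR_conv_of_real)

section \<open>Coordinates in an orthonormal basis: Bessel and Riesz-Fischer\<close>

lemma cinner_onb:
  assumes "orthonormal_basis e"
  shows "cinner (e m) (e n) = (if m = n then 1 else 0)"
  using assms by (simp add: orthonormal_basis_def)

lemma norm_onb:
  assumes "orthonormal_basis e"
  shows "norm (e n) = 1"
  by (simp add: norm_eq_sqrt_cinner cinner_onb[OF assms])

text \<open>The difference is orthogonal to the span of the basis, by continuity also to its
  closure, and hence to itself.\<close>

lemma onb_eqI:
  fixes e :: "nat \<Rightarrow> 'a::complex_hilbert"
  assumes e: "orthonormal_basis e" and eq: "\<And>m. cinner x (e m) = cinner y (e m)"
  shows "x = y"
proof -
  define z where "z = x - y"
  have z: "cinner z (e m) = 0" for m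
    by (simp add: z_def cinner_diff_left eq)
  have "cinner z v = 0" if "v \<in> cspan (range e)" for v
    using that
    by (induction rule: complex_vector.span_induct_alt)
       (auto simp: cinner_add_right cinner_scaleC_right z)
  moreover have "closed {v. cinner z v = 0}"
    using bounded_linear_cinner_right[of z]
    by (intro closed_Collect_eq continuous_on_const)
       (simp add: linear_continuous_on)
  ultimately have "closure (cspan (range e)) \<subseteq> {v. cinner z v = 0}"
    by (intro closure_minimal) auto
  then have "cinner z z = 0"
    using e unfolding orthonormal_basis_def by blast
  then show ?thesis by (simp add: cinner_eq_zero_iff z_def)
qed

lemma cinner_sum_onb:
  fixes e :: "nat \<Rightarrow> 'a::complex_hilbert"
  assumes "orthonormal_basis e" "finite I"
  shows "cinner (\<Sum>i\<in>I. c i *\<^sub>C e i) (e m) = (if m \<in> I then c m else 0)"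
  using assms(2) by (simp add: cinner_sum_left cinner_scaleC_left cinner_onb[OF assms(1)]
      if_distrib[of "\<lambda>x. _ * x"] sum.delta cong: if_cong)

lemma norm_sum_onb:
  fixes e :: "nat \<Rightarrow> 'a::complex_hilbert"
  assumes "orthonormal_basis e" "finite I"
  shows "(norm (\<Sum>i\<in>I. c i *\<^sub>C e i))\<^sup>2 = (\<Sum>i\<in>I. (cmod (c i))\<^sup>2)"
proof -
  let ?s = "\<Sum>i\<in>I. c i *\<^sub>C e i"
  have "cinner ?s ?s = (\<Sum>i\<in>I. c i * cinner (e i) ?s)"
    by (simp add: cinner_sum_left[of _ I] cinner_scaleC_left)
  also have "\<dots> = (\<Sum>i\<in>I. c i * cnj (c i))"
    by (intro sum.cong refl, subst cinner_commute, subst cinner_sum_onb[OF assms]) auto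
  also have "\<dots> = complex_of_real (\<Sum>i\<in>I. (cmod (c i))\<^sup>2)"
    by (simp add: complex_norm_square del: of_real_power)
  finally show ?thesis
    unfolding cinner_self by (simp only: of_real_eq_iff)
qed

text \<open>The partial sum is an orthogonal projection of \<open>x\<close>, so the squared norm of
  the residual is exactly the difference of the two sides.\<close>

lemma bessel:
  fixes e :: "nat \<Rightarrow> 'a::complex_hilbert"
  assumes e: "orthonormal_basis e"
  shows "(\<Sum>k<n. (cmod (cinner x (e k)))\<^sup>2) \<le> (norm x)\<^sup>2"
proof -
  let ?c = "\<lambda>k. cinner x (e k)"
  let ?s = "\<Sum>k<n. ?c k *\<^sub>C e k"
  let ?N = "\<Sum>k<n. (cmod (?c k))\<^sup>2"
  have "cinner ?s x = (\<Sum>k<n. ?c k * cnj (?c k))"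
    by (simp add: cinner_sum_left cinner_scaleC_left cinner_commute[of "e _" x])
  also have "\<dots> = complex_of_real ?N"
    by (simp add: complex_norm_square del: of_real_power)
  finally have sx: "cinner ?s x = complex_of_real ?N" .
  then have xs: "cinner x ?s = complex_of_real ?N"
    by (subst cinner_commute) simp
  have ss: "cinner ?s ?s = complex_of_real ?N"
    unfolding cinner_self norm_sum_onb[OF e finite_lessThan] ..
  have "complex_of_real ((norm (x - ?s))\<^sup>2) = complex_of_real ((norm x)\<^sup>2 - ?N)"
    unfolding cinner_self[symmetric] cinner_diff_left cinner_diff_right sx xs ss
    by (simp add: cinner_self)
  then have "(norm (x - ?s))\<^sup>2 = (norm x)\<^sup>2 - ?N"
    by (simp only: of_real_eq_iff)
  then show ?thesis by (smt (verit) zero_le_power2)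
qed

text \<open>By orthonormality the Cauchy criterion for the vector series reduces to that for the
  squared coefficients; the norm bound survives the limit of the partial sums.\<close>

lemma riesz_fischer:
  fixes e :: "nat \<Rightarrow> 'a::complex_hilbert"
  assumes e: "orthonormal_basis e" and B: "\<And>n. (\<Sum>k<n. (cmod (c k))\<^sup>2) \<le> B\<^sup>2" "B \<ge> 0"
  obtains x where "\<And>m. cinner x (e m) = c m" and "norm x \<le> B"
proof -
  let ?s = "\<lambda>n. \<Sum>k<n. c k *\<^sub>C e k"
  have "summable (\<lambda>k. (cmod (c k))\<^sup>2)"
    by (rule bounded_imp_summable[of _ "B\<^sup>2"])
       (auto simp: B lessThan_Suc_atMost[symmetric] simp del: sum.lessThan_Suc)
  then have sm: "summable (\<lambda>k. c k *\<^sub>C e k)"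
    unfolding summable_Cauchy
  proof (intro allI impI)
    fix \<epsilon> :: real
    assume *: "\<forall>\<epsilon>>0. \<exists>N. \<forall>m\<ge>N. \<forall>n. norm (\<Sum>k = m..<n. (cmod (c k))\<^sup>2) < \<epsilon>" and "\<epsilon> > 0"
    then obtain N where N: "\<And>m n. m \<ge> N \<Longrightarrow> norm (\<Sum>k = m..<n. (cmod (c k))\<^sup>2) < \<epsilon>\<^sup>2"
      by (meson zero_less_power)
    have "norm (\<Sum>k = m..<n. c k *\<^sub>C e k) < \<epsilon>" if "m \<ge> N" for m n
    proof -
      have "(norm (\<Sum>k = m..<n. c k *\<^sub>C e k))\<^sup>2 < \<epsilon>\<^sup>2"
        unfolding norm_sum_onb[OF e finite_atLeastLessThan] using N[OF that, of n] by simp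
      then show ?thesis using \<open>\<epsilon> > 0\<close> by (simp add: power_less_imp_less_base)
    qed
    then show "\<exists>N. \<forall>m\<ge>N. \<forall>n. norm (\<Sum>k = m..<n. c k *\<^sub>C e k) < \<epsilon>" by blast
  qed
  let ?x = "\<Sum>k. c k *\<^sub>C e k"
  have lim: "?s \<longlonglongrightarrow> ?x" using sm by (simp add: summable_LIMSEQ)
  show ?thesis
  proof (rule that)
    fix m
    have "(\<lambda>n. cinner (?s n) (e m)) \<longlonglongrightarrow> cinner ?x (e m)"
      by (rule bounded_linear.tendsto[OF bounded_linear_cinner_left lim])
    moreover have "(\<lambda>n. cinner (?s n) (e m)) \<longlonglongrightarrow> c m"
      by (rule tendsto_eventually, rule eventually_sequentiallyI[of "Suc m"])
         (simp add: cinner_sum_onb[OF e])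
    ultimately show "cinner ?x (e m) = c m" by (rule LIMSEQ_unique)
  next
    have "norm (?s n) \<le> B" for n
      using B(1)[of n] norm_sum_onb[OF e, of "{..<n}" c] by (intro power2_le_imp_le[OF _ B(2)]) simp
    then show "norm ?x \<le> B"
      by (intro tendsto_upperbound[OF tendsto_norm[OF lim]]) auto
  qed
qed

section \<open>Substochastic real matrices and the contractions they define\<close>

definition substochastic :: "(nat \<Rightarrow> nat \<Rightarrow> real) \<Rightarrow> bool" where
  "substochastic A \<longleftrightarrow> (\<forall>m k. 0 \<le> A m k) \<and>
     (\<forall>m. summable (A m) \<and> suminf (A m) \<le> 1) \<and>
     (\<forall>k. summable (\<lambda>m. A m k) \<and> (\<Sum>m. A m k) \<le> 1)"

lemma substochastic_le_1:
  assumes "substochastic A"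
  shows "A m k \<le> 1"
proof -
  have "sum (A m) {k} \<le> suminf (A m)"
    using assms unfolding substochastic_def by (intro sum_le_suminf) auto
  then show ?thesis using assms unfolding substochastic_def by (simp add: order_trans)
qed

text \<open>Schur test: splitting \<open>A m k\<close> into two square roots, Cauchy-Schwarz
  consumes the row sums; exchanging the summations then consumes the column sums, and Bessel's
  inequality finishes. Columns are truncated at \<open>n\<close> first, and the limit in
  \<open>n\<close> is taken last.\<close>

lemma schur_test:
  fixes e :: "nat \<Rightarrow> 'a::complex_hilbert"
  assumes e: "orthonormal_basis e" and A: "substochastic A"
  shows "summable (\<lambda>k. of_real (A m k) * cinner x (e k))"
    and "(\<Sum>m<M. (cmod (\<Sum>k. of_real (A m k) * cinner x (e k)))\<^sup>2) \<le> (norm x)\<^sup>2"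
proof -
  let ?c = "\<lambda>k. cinner x (e k)"
  have A0: "A m k \<ge> 0" and Ar: "summable (A m)" "suminf (A m) \<le> 1"
    and Ac: "summable (\<lambda>m. A m k)" "(\<Sum>m. A m k) \<le> 1" for m k
    using A unfolding substochastic_def by auto
  have c: "cmod (?c k) \<le> norm x" for k
    using cmod_cinner_le[of x "e k"] by (simp add: norm_onb[OF e])
  show sm: "summable (\<lambda>k. of_real (A m k) * ?c k)" for m
    by (rule summable_comparison_test'[where g = "\<lambda>k. A m k * norm x"])
       (auto simp: norm_mult A0 c Ar(1) summable_mult2 intro!: mult_left_mono)
  have row: "(cmod (\<Sum>k<n. of_real (A m k) * ?c k))\<^sup>2 \<le> (\<Sum>k<n. A m k * (cmod (?c k))\<^sup>2)" for m n
  proof -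
    have "cmod (\<Sum>k<n. of_real (A m k) * ?c k) \<le> (\<Sum>k<n. sqrt (A m k) * (sqrt (A m k) * cmod (?c k)))"
      by (rule order_trans[OF norm_sum]) (simp add: norm_mult A0 flip: mult.assoc)
    then have "(cmod (\<Sum>k<n. of_real (A m k) * ?c k))\<^sup>2
        \<le> (\<Sum>k<n. sqrt (A m k) * (sqrt (A m k) * cmod (?c k)))\<^sup>2"
      by (rule power_mono) simp
    also have "\<dots> \<le> (\<Sum>k<n. (sqrt (A m k))\<^sup>2) * (\<Sum>k<n. (sqrt (A m k) * cmod (?c k))\<^sup>2)"
      by (rule Cauchy_Schwarz_ineq_sum)
    also have "\<dots> = (\<Sum>k<n. A m k) * (\<Sum>k<n. A m k * (cmod (?c k))\<^sup>2)"
      by (simp add: A0 power_mult_distrib)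
    also have "\<dots> \<le> 1 * (\<Sum>k<n. A m k * (cmod (?c k))\<^sup>2)"
      by (intro mult_right_mono sum_nonneg)
         (auto simp: A0 intro!: order_trans[OF sum_le_suminf Ar(2)] Ar(1))
    finally show ?thesis by simp
  qed
  have fin: "(\<Sum>m<M. (cmod (\<Sum>k<n. of_real (A m k) * ?c k))\<^sup>2) \<le> (norm x)\<^sup>2" for n
  proof -
    have "(\<Sum>m<M. (cmod (\<Sum>k<n. of_real (A m k) * ?c k))\<^sup>2)
        \<le> (\<Sum>m<M. \<Sum>k<n. A m k * (cmod (?c k))\<^sup>2)"
      by (intro sum_mono row)
    also have "\<dots> = (\<Sum>k<n. (\<Sum>m<M. A m k) * (cmod (?c k))\<^sup>2)"
      by (subst sum.swap) (simp add: sum_distrib_right)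
    also have "\<dots> \<le> (\<Sum>k<n. 1 * (cmod (?c k))\<^sup>2)"
      by (intro sum_mono mult_right_mono)
         (auto simp: A0 intro!: order_trans[OF sum_le_suminf Ac(2)] Ac(1))
    also have "\<dots> \<le> (norm x)\<^sup>2" using bessel[OF e] by simp
    finally show ?thesis .
  qed
  have "(\<lambda>n. \<Sum>m<M. (cmod (\<Sum>k<n. of_real (A m k) * ?c k))\<^sup>2)
      \<longlonglongrightarrow> (\<Sum>m<M. (cmod (\<Sum>k. of_real (A m k) * ?c k))\<^sup>2)"
    by (intro tendsto_intros summable_LIMSEQ sm)
  then show "(\<Sum>m<M. (cmod (\<Sum>k. of_real (A m k) * ?c k))\<^sup>2) \<le> (norm x)\<^sup>2"
    by (rule tendsto_upperbound) (auto simp: fin)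
qed

lemma bounded_opsD:
  assumes "a \<in> bounded_ops"
  shows "bounded_linear a" "a (c *\<^sub>C x) = c *\<^sub>C a x"
  using assms by (auto simp: bounded_ops_def)

lemma entry_eqI:
  fixes e :: "nat \<Rightarrow> 'a::complex_hilbert"
  assumes e: "orthonormal_basis e" and a: "a \<in> bounded_ops" and b: "b \<in> bounded_ops"
    and eq: "\<And>m k. entry e a m k = entry e b m k"
  shows "a = b"
proof
  fix x
  interpret A: bounded_linear a using a by (rule bounded_opsD)
  interpret B: bounded_linear b using b by (rule bounded_opsD)
  have ek: "a (e k) = b (e k)" for k
    using eq by (intro onb_eqI[OF e]) (simp add: entry_def)
  have "a v = b v" if "v \<in> cspan (range e)" for v
    using that
    by (induction rule: complex_vector.span_induct_alt)
       (auto simp: A.add B.add A.zero B.zero ek bounded_opsD(2)[OF a] bounded_opsD(2)[OF b])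
  moreover have "closed {v. a v = b v}"
    by (intro closed_Collect_eq A.continuous_on B.continuous_on continuous_on_id)
  ultimately have "closure (cspan (range e)) \<subseteq> {v. a v = b v}"
    by (intro closure_minimal) auto
  then show "a x = b x"
    using e unfolding orthonormal_basis_def by blast
qed

text \<open>The Schur test makes the prescribed coordinates square-summable with bound
  \<open>norm x\<close>, so Riesz-Fischer supplies the image vector; linearity follows since
  coordinates determine a vector. Perturbed matrices therefore still come from bounded
  operators.\<close>

lemma substochastic_operator:
  fixes e :: "nat \<Rightarrow> 'a::complex_hilbert"
  assumes e: "orthonormal_basis e" and A: "substochastic A"
  obtains a where "a \<in> bounded_ops" "\<And>m k. entry e a m k = of_real (A m k)"
proof -
  let ?y = "\<lambda>x m. \<Sum>k. of_real (A m k) * cinner x (e k)"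
  note sm = schur_test(1)[OF e A]
  have "\<exists>z. (\<forall>m. cinner z (e m) = ?y x m) \<and> norm z \<le> norm x" for x
    using riesz_fischer[OF e schur_test(2)[OF e A], of x] by (metis norm_ge_zero)
  then obtain a where a: "\<And>x m. cinner (a x) (e m) = ?y x m" and na: "\<And>x. norm (a x) \<le> norm x"
    by metis
  have add: "a (x + y) = a x + a y" for x y
    by (rule onb_eqI[OF e]) (simp add: a cinner_add_left suminf_add sm distrib_left)
  have sc: "a (c *\<^sub>C x) = c *\<^sub>C a x" for c x
    by (rule onb_eqI[OF e])
       (simp add: a cinner_scaleC_left sm mult.left_commute[of _ c] suminf_mult)
  have "bounded_linear a"
    using na sc by (intro bounded_linear_intro[where K = 1]) (auto simp: add simp flip: scaleC_of_real)
  then have "a \<in> bounded_ops" by (simp add: bounded_ops_def sc)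
  moreover have "entry e a m k = of_real (A m k)" for m k
  proof -
    have "entry e a m k = (\<Sum>j. if j = k then of_real (A m k) else 0)"
      unfolding entry_def a by (intro arg_cong[of _ _ suminf] ext) (simp add: cinner_onb[OF e])
    also have "\<dots> = of_real (A m k)"
      by (subst suminf_finite[of "{k}"]) auto
    finally show ?thesis .
  qed
  ultimately show ?thesis by (rule that)
qed

section \<open>Flows through a fractional edge\<close>

text \<open>Flow entering a vertex along an edge of weight \<open>q\<close> is spread over the
  remaining capacity \<open>1 - q\<close>, including the part that no edge occupies; this is the
  resulting change of the flow-to-weight ratio.\<close>

definition odds :: "real \<Rightarrow> real" where
  "odds q = q / (1 - q)"

text \<open>\<open>p * q \<le> (1 - p) * (1 - q)\<close> is a rearrangement of
  \<open>p + q \<le> 1\<close>.\<close>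

lemma odds_mult_le_1:
  assumes "0 \<le> p" "0 \<le> q" "p < 1" "q < 1" "p + q \<le> 1"
  shows "odds p * odds q \<le> 1"
proof -
  have "0 < (1 - p) * (1 - q)" using assms by simp
  moreover have "p * q \<le> (1 - p) * (1 - q)" using assms by (simp add: algebra_simps)
  ultimately show ?thesis by (simp add: odds_def)
qed

text \<open>Rows and columns of the matrix will both become vertices of type \<open>'v\<close>, with
  \<open>w\<close> the symmetric weighting whose edges are the entries; the edge from
  \<open>x0\<close> to \<open>y0\<close> is the fractional entry.\<close>

locale fractional_edge =
  fixes w :: "'v \<Rightarrow> 'v \<Rightarrow> real" and x0 y0 :: 'v
  assumes sym: "w x y = w y x" and nonneg: "0 \<le> w x y" and loopless: "w x x = 0"
    and summable: "w x summable_on UNIV" and total: "infsum (w x) UNIV \<le> 1"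
    and pos: "0 < w x0 y0" and less_1: "w x0 y0 < 1"
begin

definition small_flow :: "('v \<Rightarrow> 'v \<Rightarrow> real) \<Rightarrow> bool" where
  "small_flow \<theta> \<longleftrightarrow> (\<forall>x y. \<theta> y x = - \<theta> x y) \<and> (\<forall>x y. \<bar>\<theta> x y\<bar> \<le> w x y) \<and>
     (\<exists>x y. \<theta> x y \<noteq> 0) \<and> (\<forall>x. \<bar>infsum (\<theta> x) UNIV\<bar> \<le> 1 - infsum (w x) UNIV)"

text \<open>\<open>s x\<close> is the net outflow at \<open>x\<close>. Finite support within the
  edges is what later allows scaling below \<open>w\<close>.\<close>

definition finite_flow :: "('v \<Rightarrow> 'v \<Rightarrow> real) \<Rightarrow> ('v \<Rightarrow> real) \<Rightarrow> bool" where
  "finite_flow F s \<longleftrightarrow> (\<forall>x y. F y x = - F x y) \<and> (\<forall>x. (F x has_sum s x) UNIV) \<and>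
     finite {(x, y). F x y \<noteq> 0} \<and> (\<forall>x y. F x y \<noteq> 0 \<longrightarrow> 0 < w x y)"

lemma small_flow_of_circulation:
  assumes F: "finite_flow F (\<lambda>_. 0)" and "F a b \<noteq> 0"
  shows "\<exists>\<theta>. small_flow \<theta>"
proof -
  let ?S = "{(x, y). F x y \<noteq> 0}"
  define \<epsilon> where "\<epsilon> = Min ((\<lambda>(x, y). w x y / \<bar>F x y\<bar>) ` ?S)"
  have S: "finite ?S" and wS: "\<And>x y. F x y \<noteq> 0 \<Longrightarrow> 0 < w x y"
    using F unfolding finite_flow_def by blast+
  have \<epsilon>: "\<epsilon> > 0"
    unfolding \<epsilon>_def using S assms(2) wS by (subst Min_gr_iff) auto
  have le: "\<epsilon> * \<bar>F x y\<bar> \<le> w x y" for x y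
  proof (cases "F x y = 0")
    case False
    then have "\<epsilon> \<le> w x y / \<bar>F x y\<bar>"
      unfolding \<epsilon>_def using S by (intro Min_le) auto
    then show ?thesis using False by (simp add: field_simps)
  qed (simp add: nonneg)
  have inf: "infsum (\<lambda>y. \<epsilon> * F x y) UNIV = 0" for x
  proof -
    have "(F x has_sum 0) UNIV" using F unfolding finite_flow_def by blast
    from has_sum_cmult_right[OF this, of \<epsilon>] show ?thesis by (simp add: infsumI)
  qed
  have "small_flow (\<lambda>x y. \<epsilon> * F x y)"
    unfolding small_flow_def
  proof (intro conjI allI)
    show "\<epsilon> * F y x = - (\<epsilon> * F x y)" for x y
      using F unfolding finite_flow_def by (metis mult_minus_right)
    show "\<bar>\<epsilon> * F x y\<bar> \<le> w x y" for x y
      using le[of x y] \<epsilon> by (simp add: abs_mult)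
    show "\<exists>x y. \<epsilon> * F x y \<noteq> 0"
      using \<epsilon> assms(2) by auto
    show "\<bar>infsum (\<lambda>y. \<epsilon> * F x y) UNIV\<bar> \<le> 1 - infsum (w x) UNIV" for x
      using total[of x] by (simp only: inf)
  qed
  then show ?thesis by blast
qed

lemma finite_flow_diff:
  assumes F: "finite_flow F s" and G: "finite_flow G t"
  shows "finite_flow (\<lambda>x y. F x y - G x y) (\<lambda>x. s x - t x)"
  unfolding finite_flow_def
proof (intro conjI allI impI)
  have "{(x, y). F x y - G x y \<noteq> 0} \<subseteq> {(x, y). F x y \<noteq> 0} \<union> {(x, y). G x y \<noteq> 0}" by auto
  then show "finite {(x, y). F x y - G x y \<noteq> 0}"
    using F G unfolding finite_flow_def by (meson finite_UnI finite_subset)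
  show "((\<lambda>y. F x y - G x y) has_sum s x - t x) UNIV" for x
  proof -
    have "(F x has_sum s x) UNIV" "(G x has_sum t x) UNIV"
      using F G unfolding finite_flow_def by blast+
    from has_sum_add[OF this(1) has_sum_uminusI[OF this(2)]] show ?thesis by simp
  qed
  show "F y x - G y x = - (F x y - G x y)" for x y
    using F G unfolding finite_flow_def by (metis minus_diff_eq minus_diff_minus)
  show "0 < w x y" if "F x y - G x y \<noteq> 0" for x y
    using F G that unfolding finite_flow_def by (metis diff_zero)
qed

definition edge_flow :: "'v \<Rightarrow> 'v \<Rightarrow> 'v \<Rightarrow> 'v \<Rightarrow> real" where
  "edge_flow u v x y = of_bool (x = u \<and> y = v) - of_bool (x = v \<and> y = u)"

lemma has_sum_of_bool_eq: "((\<lambda>y. of_bool (P \<and> y = v) :: real) has_sum of_bool P) UNIV"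
  by (rule has_sum_finite_neutralI[of "{v}"]) auto

lemma edge_flow_eq:
  "edge_flow u v x = (\<lambda>y. of_bool (x = u \<and> y = v) + - of_bool (x = v \<and> y = u))"
  by (rule ext) (simp add: edge_flow_def)

lemma edge_flow_nonzero: "edge_flow u v x y \<noteq> 0 \<Longrightarrow> (x, y) \<in> {(u, v), (v, u)}"
  by (rule ccontr) (auto simp: edge_flow_def)

lemma finite_flow_edge:
  assumes "0 < w u v"
  shows "finite_flow (edge_flow u v) (\<lambda>x. of_bool (x = u) - of_bool (x = v))"
  unfolding finite_flow_def
proof (intro conjI allI impI)
  have "{(x, y). edge_flow u v x y \<noteq> 0} \<subseteq> {(u, v), (v, u)}"
    using edge_flow_nonzero by blast
  then show "finite {(x, y). edge_flow u v x y \<noteq> 0}"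
    by (rule finite_subset) simp
  show "(edge_flow u v x has_sum of_bool (x = u) - of_bool (x = v)) UNIV" for x
    unfolding edge_flow_eq diff_conv_add_uminus
    by (intro has_sum_add has_sum_uminusI has_sum_of_bool_eq)
  show "edge_flow u v y x = - edge_flow u v x y" for x y
    by (simp add: edge_flow_def conj_commute)
  show "0 < w x y" if "edge_flow u v x y \<noteq> 0" for x y
    using edge_flow_nonzero[OF that] assms sym by (metis insertE prod.inject singletonD)
qed

section \<open>Breadth-first tree of the component of the fractional edge\<close>

definition Edges :: "('v \<times> 'v) set" where
  "Edges = {(x, y). 0 < w x y}"

definition component :: "'v set" where
  "component = Edges\<^sup>* `` {x0}"

definition depth :: "'v \<Rightarrow> nat" where
  "depth v = (LEAST n. (x0, v) \<in> Edges ^^ n)"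

text \<open>Giving the root \<open>x0\<close> the parent \<open>y0\<close> provides every vertex of
  the component with a parent edge and makes the fractional edge the only one whose ends are parents
  of each other.\<close>

definition parent :: "'v \<Rightarrow> 'v" where
  "parent v = (if v = x0 then y0
     else SOME u. u \<in> component \<and> 0 < w u v \<and> depth v = Suc (depth u))"

lemma x0_component: "x0 \<in> component"
  by (simp add: component_def)

lemma component_edge:
  assumes "v \<in> component" "0 < w v z"
  shows "z \<in> component"
  using assms by (auto simp: component_def Edges_def intro: rtrancl_into_rtrancl)

lemma depth_x0: "depth x0 = 0"
  by (simp add: depth_def)

lemma depth_relpow:
  assumes "v \<in> component"
  shows "(x0, v) \<in> Edges ^^ depth v"
proof -
  have "\<exists>n. (x0, v) \<in> Edges ^^ n"
    using assms by (auto simp: component_def rtrancl_power)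
  then show ?thesis unfolding depth_def by (rule LeastI_ex)
qed

lemma depth_le: "(x0, v) \<in> Edges ^^ n \<Longrightarrow> depth v \<le> n"
  unfolding depth_def by (rule Least_le)

lemma depth_eq_0: "v \<in> component \<Longrightarrow> depth v = 0 \<longleftrightarrow> v = x0"
  using depth_relpow[of v] depth_x0 by auto

text \<open>The last vertex before \<open>v\<close> on a shortest path serves: were it any closer to
  \<open>x0\<close>, so would \<open>v\<close> be.\<close>

lemma parent_exists:
  assumes v: "v \<in> component" "v \<noteq> x0"
  shows "\<exists>u. u \<in> component \<and> 0 < w u v \<and> depth v = Suc (depth u)"
proof -
  obtain n where n: "depth v = Suc n"
    using depth_eq_0[OF v(1)] v(2) by (cases "depth v") auto
  then obtain u where u: "(x0, u) \<in> Edges ^^ n" "(u, v) \<in> Edges"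
    using depth_relpow[OF v(1)] by auto
  have uC: "u \<in> component"
    using u(1) by (auto simp: component_def rtrancl_power)
  have "(x0, v) \<in> Edges ^^ Suc (depth u)"
    using depth_relpow[OF uC] u(2) by auto
  then have "depth v \<le> Suc (depth u)" by (rule depth_le)
  with depth_le[OF u(1)] n have "depth v = Suc (depth u)" by simp
  with uC u(2) show ?thesis by (auto simp: Edges_def)
qed

lemma x0_neq_y0: "x0 \<noteq> y0"
  using pos loopless[of x0] by auto

lemma y0_component: "y0 \<in> component"
  using component_edge[OF x0_component pos] .

lemma parent_x0: "parent x0 = y0"
  by (simp add: parent_def)

lemma parent_nonroot:
  assumes "v \<in> component" "v \<noteq> x0"
  shows "parent v \<in> component" "0 < w (parent v) v" "depth v = Suc (depth (parent v))"
  using someI_ex[OF parent_exists[OF assms]] assms(2) by (auto simp: parent_def)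

lemma parent_component: "v \<in> component \<Longrightarrow> parent v \<in> component"
  by (cases "v = x0") (auto simp: parent_x0 y0_component parent_nonroot)

lemma parent_edge: "v \<in> component \<Longrightarrow> 0 < w (parent v) v"
  by (cases "v = x0") (auto simp: parent_x0 pos sym[of y0 x0] parent_nonroot)

lemma parent_y0: "parent y0 = x0"
proof -
  have "depth y0 \<le> 1"
    using pos by (intro depth_le) (auto simp: Edges_def)
  then have "depth (parent y0) = 0"
    using parent_nonroot(3)[OF y0_component] x0_neq_y0 by auto
  then show ?thesis
    using depth_eq_0[OF parent_component[OF y0_component]] by simp
qed

text \<open>Away from the root each step to the parent lowers the depth, so a 2-cycle of
  \<open>parent\<close> passes through \<open>x0\<close>.\<close>

lemma parent_parent_eq:
  assumes v: "v \<in> component" "parent (parent v) = v"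
  shows "v = x0 \<or> v = y0"
proof (rule ccontr)
  assume "\<not> ?thesis"
  moreover from this have "parent v \<noteq> x0" using v parent_x0 by auto
  ultimately show False
    using parent_nonroot(3)[of v] parent_nonroot(3)[of "parent v"] v parent_component[of v] by auto
qed

text \<open>Induction on depth, appending the last tree edge to the path to the parent. The support
  on parent edges is recorded so that these flows vanish on any non-tree edge.\<close>

lemma path_flow:
  assumes "v \<in> component"
  shows "\<exists>F. finite_flow F (\<lambda>x. of_bool (x = x0) - of_bool (x = v)) \<and>
           (\<forall>x y. F x y \<noteq> 0 \<longrightarrow> y = parent x \<or> x = parent y)"
  using assms
proof (induction "depth v" arbitrary: v)
  case 0
  then have "v = x0" using depth_eq_0 by simp
  then show ?case by (intro exI[of _ "\<lambda>_ _. 0"]) (simp add: finite_flow_def)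
next
  case (Suc n)
  then have v: "v \<noteq> x0" using depth_x0 by auto
  let ?u = "parent v"
  obtain F where F: "finite_flow F (\<lambda>x. of_bool (x = x0) - of_bool (x = ?u))"
    and Fp: "\<And>x y. F x y \<noteq> 0 \<Longrightarrow> y = parent x \<or> x = parent y"
    using Suc.hyps(1)[of ?u] Suc.hyps(2) parent_nonroot[OF Suc.prems v] by auto
  have "0 < w v ?u" using parent_edge[OF Suc.prems] sym by simp
  from finite_flow_diff[OF F finite_flow_edge[OF this]]
  have "finite_flow (\<lambda>x y. F x y - edge_flow v ?u x y) (\<lambda>x. of_bool (x = x0) - of_bool (x = v))"
    by simp
  moreover have "\<forall>x y. F x y - edge_flow v ?u x y \<noteq> 0 \<longrightarrow> y = parent x \<or> x = parent y"
  proof (intro allI impI)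
    fix x y assume "F x y - edge_flow v ?u x y \<noteq> 0"
    then have "F x y \<noteq> 0 \<or> edge_flow v ?u x y \<noteq> 0" by auto
    then show "y = parent x \<or> x = parent y"
      using Fp edge_flow_nonzero[of v ?u x y] by blast
  qed
  ultimately show ?case by blast
qed

text \<open>A non-tree edge closes a cycle with the tree paths from \<open>x0\<close> to its two
  ends. The path flows vanish on that edge, so the circulation is nonzero there.\<close>

lemma small_flow_nontree_edge:
  assumes v: "v \<in> component" and z: "0 < w v z" "z \<noteq> parent v" "v \<noteq> parent z"
  shows "\<exists>\<theta>. small_flow \<theta>"
proof -
  obtain F where F: "finite_flow F (\<lambda>x. of_bool (x = x0) - of_bool (x = v))"
    and Fp: "\<And>x y. F x y \<noteq> 0 \<Longrightarrow> y = parent x \<or> x = parent y"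
    using path_flow[OF v] by blast
  obtain G where G: "finite_flow G (\<lambda>x. of_bool (x = x0) - of_bool (x = z))"
    and Gp: "\<And>x y. G x y \<noteq> 0 \<Longrightarrow> y = parent x \<or> x = parent y"
    using path_flow[OF component_edge[OF v z(1)]] by blast
  have "finite_flow (\<lambda>x y. F x y - G x y - edge_flow z v x y) (\<lambda>_. 0)"
    using finite_flow_diff[OF finite_flow_diff[OF F G] finite_flow_edge[of z v]] z(1) sym by simp
  moreover have "F v z = 0" "G v z = 0" using Fp Gp z by blast+
  then have "F v z - G v z - edge_flow z v v z \<noteq> 0"
    using z(1) loopless[of v] by (auto simp: edge_flow_def)
  ultimately show ?thesis by (rule small_flow_of_circulation)
qed

section \<open>Proportional splitting of a flow in a tree\<close>

lemma weight_add_le: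
  assumes "y \<noteq> z"
  shows "w x y + w x z \<le> 1"
proof -
  have "sum (w x) {y, z} \<le> infsum (w x) UNIV"
    by (rule finite_sum_le_infsum[OF summable]) (auto simp: nonneg)
  then show ?thesis using assms total[of x] by simp
qed

text \<open>On the root edge this is \<open>less_1\<close>. Elsewhere the parent also has its own
  parent edge, of positive weight, and the two weights add up to at most 1.\<close>

lemma parent_weight_less_1:
  assumes v: "v \<in> component"
  shows "w (parent v) v < 1"
proof (cases "v = x0 \<or> v = y0")
  case True
  then show ?thesis using less_1 parent_x0 parent_y0 sym[of y0 x0] by auto
next
  case False
  then have "parent (parent v) \<noteq> v" using parent_parent_eq[OF v] by blast
  then have "w (parent v) v + w (parent v) (parent (parent v)) \<le> 1"
    by (intro weight_add_le) auto
  then show ?thesis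
    using parent_edge[OF parent_component[OF v]] sym[of "parent v"] by simp
qed

text \<open>In a tree, the perturbation enters each vertex through the parent edge and leaves through the
  remaining edges proportionally to their weights; the ratio of the perturbation to the weight
  on an edge below \<open>v\<close> is thus \<open>odds (w (parent v) v)\<close> times the ratio on the edge above.\<close>

primrec ratio_at :: "nat \<Rightarrow> 'v \<Rightarrow> real" where
  "ratio_at 0 v = -1"
| "ratio_at (Suc n) v = (if v = y0 then 1
     else ratio_at n (parent v) * odds (w (parent (parent v)) (parent v)))"

text \<open>The flow into \<open>v\<close> through its parent edge, per unit of weight. It is
  \<open>-1\<close> at \<open>x0\<close> and \<open>1\<close> at \<open>y0\<close> because the root
  edge carries flow from \<open>x0\<close> to \<open>y0\<close>. For \<open>v\<close> in the
  component, \<open>depth v\<close> counts the parent steps to \<open>x0\<close>.\<close>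

definition ratio :: "'v \<Rightarrow> real" where
  "ratio v = ratio_at (depth v) v"

lemma ratio_x0: "ratio x0 = -1"
  by (simp add: ratio_def depth_x0)

lemma ratio_y0: "ratio y0 = 1"
  using parent_nonroot(3)[OF y0_component] x0_neq_y0 by (auto simp: ratio_def)

lemma ratio_rec:
  assumes "v \<in> component" "v \<noteq> x0" "v \<noteq> y0"
  shows "ratio v = ratio (parent v) * odds (w (parent (parent v)) (parent v))"
  using parent_nonroot(3)[OF assms(1,2)] assms(3) by (simp add: ratio_def)

lemma odds_parent_nonneg: "v \<in> component \<Longrightarrow> 0 \<le> odds (w (parent v) v)"
  using parent_weight_less_1[of v] nonneg by (simp add: odds_def)

text \<open>The two quantities to be bounded start, at either end of the root edge, as 1 and
  \<open>odds (w x0 y0)\<close>.\<close>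

definition bnd :: real where
  "bnd = max 1 (odds (w x0 y0))"

text \<open>The second conjunct is what carries the induction: consecutive factors
  multiply to at most 1.\<close>

lemma ratio_bound:
  assumes "v \<in> component"
  shows "\<bar>ratio v\<bar> \<le> bnd \<and> \<bar>ratio v\<bar> * odds (w (parent v) v) \<le> bnd"
  using assms
proof (induction "depth v" arbitrary: v)
  case 0
  then have "v = x0" using depth_eq_0 by simp
  then show ?case by (simp add: ratio_x0 parent_x0 bnd_def sym[of y0 x0])
next
  case (Suc n)
  then have v: "v \<noteq> x0" using depth_x0 by auto
  let ?u = "parent v"
  show ?case
  proof (cases "v = y0")
    case True
    then show ?thesis by (simp add: ratio_y0 parent_y0 bnd_def)
  next
    case False
    have uC: "?u \<in> component" using parent_component[OF Suc.prems] .
    have IH: "\<bar>ratio ?u\<bar> \<le> bnd" "\<bar>ratio ?u\<bar> * odds (w (parent ?u) ?u) \<le> bnd"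
      using Suc.hyps(1)[of ?u] Suc.hyps(2) parent_nonroot[OF Suc.prems v] by auto
    have "parent ?u \<noteq> v" using parent_parent_eq[OF Suc.prems] v False by blast
    then have "w (parent ?u) ?u + w ?u v \<le> 1"
      using weight_add_le[of "parent ?u" v ?u] sym by simp
    then have "odds (w (parent ?u) ?u) * odds (w ?u v) \<le> 1"
      using parent_weight_less_1[OF uC] parent_weight_less_1[OF Suc.prems] nonneg
      by (intro odds_mult_le_1) auto
    then have "\<bar>ratio ?u\<bar> * (odds (w (parent ?u) ?u) * odds (w ?u v)) \<le> \<bar>ratio ?u\<bar> * 1"
      by (rule mult_left_mono) simp
    then show ?thesis
      using IH ratio_rec[OF Suc.prems v False] odds_parent_nonneg[OF uC]
      by (simp add: abs_mult mult.assoc)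
  qed
qed

text \<open>Outflow through the parent edge is minus the inflow there; in a tree every other edge at
  \<open>x\<close> leads to a child \<open>y\<close>, whose own ratio measures the flow from
  \<open>x\<close> into it.\<close>

definition tree_flow :: "'v \<Rightarrow> 'v \<Rightarrow> real" where
  "tree_flow x y = (if x \<in> component \<and> 0 < w x y
     then (if y = parent x then - ratio x else ratio y) * w x y else 0)"

lemma tree_flow_antisym:
  assumes tree: "\<And>v z. v \<in> component \<Longrightarrow> 0 < w v z \<Longrightarrow> z \<noteq> parent v \<Longrightarrow> v = parent z"
  shows "tree_flow y x = - tree_flow x y"
proof (cases "x \<in> component \<and> 0 < w x y")
  case True
  then have y: "y \<in> component" "0 < w y x" using component_edge sym by auto
  have sw: "w y x = w x y" by (rule sym)
  \<comment> \<open>The first case is the root edge, where the opposite ratios at the ends give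
    antisymmetry. Any other edge is the parent edge of exactly one end, so both directions are
    computed from the same ratio.\<close>
  consider "y = parent x" "x = parent y" | "y = parent x" "x \<noteq> parent y"
    | "y \<noteq> parent x" "x = parent y"
    using tree True by blast
  then show ?thesis
  proof cases
    case 1
    then have "x = x0 \<and> y = y0 \<or> x = y0 \<and> y = x0"
      using parent_parent_eq[of x] True parent_x0 parent_y0 by auto
    moreover have "tree_flow x0 y0 = w x0 y0" "tree_flow y0 x0 = - w x0 y0"
      using pos x0_component y0_component sym[of y0 x0]
      by (simp_all add: tree_flow_def parent_x0 parent_y0 ratio_x0 ratio_y0)
    ultimately show ?thesis by auto
  next
    case 2
    from 2(2)[symmetric] show ?thesis using True y by (simp add: tree_flow_def 2(1)[symmetric] sw)
  next
    case 3
    then show ?thesis using True y by (simp add: tree_flow_def sym[of y "parent y"])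
  qed
next
  case False
  then have "\<not> (y \<in> component \<and> 0 < w y x)"
    using component_edge[of y x] sym[of x y] by auto
  then show ?thesis using False unfolding tree_flow_def by auto
qed

lemma tree_flow_sum:
  assumes tree: "\<And>v z. v \<in> component \<Longrightarrow> 0 < w v z \<Longrightarrow> z \<noteq> parent v \<Longrightarrow> v = parent z"
  shows "\<bar>infsum (tree_flow v) UNIV\<bar> \<le> bnd * (1 - infsum (w v) UNIV)"
proof (cases "v \<in> component")
  case False
  then have "tree_flow v = (\<lambda>_. 0)" by (simp add: fun_eq_iff tree_flow_def)
  moreover have "bnd \<ge> 0" by (simp add: bnd_def)
  ultimately show ?thesis using total[of v] by simp
next
  case True
  let ?u = "parent v"
  define q where "q = w ?u v"
  define r' where "r' = ratio v * odds q"
  have q: "q < 1" using parent_weight_less_1[OF True] by (simp add: q_def)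
  have uv: "w v ?u = q" unfolding q_def by (rule sym)
  have eq: "tree_flow v y = r' * w v y + (if y = ?u then - ratio v * q - r' * q else 0)" for y
  proof (cases "0 < w v y \<and> y \<noteq> ?u")
    case y: True
    then have "v = parent y" using tree True by blast
    \<comment> \<open>If the child \<open>y\<close> were an end of the root edge, \<open>v\<close>
      would be the other end and \<open>y\<close> would be its parent.\<close>
    moreover have "y \<noteq> x0" "y \<noteq> y0"
      using y calculation parent_x0 parent_y0 by auto
    ultimately have "ratio y = r'"
      using ratio_rec[of y] component_edge[OF True] y by (simp add: r'_def q_def)
    then show ?thesis using y True by (simp add: tree_flow_def)
  next
    case y: False
    then show ?thesis
      using True uv parent_edge[OF True] nonneg[of v y]
      by (auto simp: tree_flow_def q_def algebra_simps)
  qed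
  have "((\<lambda>y. if y = ?u then - ratio v * q - r' * q else 0) has_sum (- ratio v * q - r' * q)) UNIV"
    by (rule has_sum_finite_neutralI[of "{?u}"]) auto
  from has_sum_add[OF has_sum_cmult_right[OF has_sum_infsum[OF summable[of v]], of r'] this]
  have "(tree_flow v has_sum (r' * infsum (w v) UNIV + (- ratio v * q - r' * q))) UNIV"
    unfolding eq .
  then have "infsum (tree_flow v) UNIV = r' * infsum (w v) UNIV + (- ratio v * q - r' * q)"
    by (rule infsumI)
  also have "ratio v * q = r' * (1 - q)"
    using q by (simp add: r'_def odds_def)
  then have "r' * infsum (w v) UNIV + (- ratio v * q - r' * q) = - r' * (1 - infsum (w v) UNIV)"
    by (simp add: algebra_simps)
  finally have "\<bar>infsum (tree_flow v) UNIV\<bar> = \<bar>r'\<bar> * (1 - infsum (w v) UNIV)"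
    using total[of v] by (simp add: abs_mult)
  also have "\<dots> \<le> bnd * (1 - infsum (w v) UNIV)"
    using ratio_bound[OF True] odds_parent_nonneg[OF True] total[of v]
    by (intro mult_right_mono) (auto simp: r'_def q_def abs_mult)
  finally show ?thesis .
qed

lemma small_flow_exists: "\<exists>\<theta>. small_flow \<theta>"
proof (cases "\<exists>v z. v \<in> component \<and> 0 < w v z \<and> z \<noteq> parent v \<and> v \<noteq> parent z")
  case True
  then show ?thesis using small_flow_nontree_edge by blast
next
  case False
  then have tree: "\<And>v z. v \<in> component \<Longrightarrow> 0 < w v z \<Longrightarrow> z \<noteq> parent v \<Longrightarrow> v = parent z"
    by blast
  have bnd: "bnd \<ge> 1" by (simp add: bnd_def)
  have le: "\<bar>tree_flow x y\<bar> \<le> bnd * w x y" for x y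
    using ratio_bound[of x] ratio_bound[of y] component_edge[of x y] nonneg[of x y] bnd
    by (auto simp: tree_flow_def abs_mult intro!: mult_right_mono)
  have "small_flow (\<lambda>x y. tree_flow x y / bnd)"
    unfolding small_flow_def
  proof (intro conjI allI)
    show "tree_flow y x / bnd = - (tree_flow x y / bnd)" for x y
      using tree_flow_antisym[OF tree, of y x] by simp
    show "\<bar>tree_flow x y / bnd\<bar> \<le> w x y" for x y
      using le[of x y] bnd by (simp add: divide_le_eq mult.commute)
    show "\<exists>x y. tree_flow x y / bnd \<noteq> 0"
      using pos bnd x0_component
      by (intro exI[of _ x0] exI[of _ y0]) (simp add: tree_flow_def parent_x0 ratio_x0)
    show "\<bar>infsum (\<lambda>y. tree_flow x y / bnd) UNIV\<bar> \<le> 1 - infsum (w x) UNIV" for x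
      using tree_flow_sum[OF tree, of x] bnd
      by (simp add: divide_inverse infsum_cmult_left' abs_mult) (simp add: field_simps)
  qed
  then show ?thesis by blast
qed

end

section \<open>Exposed points have entries 0 and 1\<close>

text \<open>For the bipartite graph on \<open>nat + nat\<close>: weights at a row vertex live on the
  column summand and conversely, so vertex sums become row and column sums.\<close>

lemma has_sum_extend:
  assumes "inj g" "\<And>x. x \<notin> range g \<Longrightarrow> f x = 0"
  shows "(f has_sum s) UNIV \<longleftrightarrow> ((\<lambda>k. f (g k)) has_sum s) UNIV"
proof -
  have "(f has_sum s) UNIV \<longleftrightarrow> (f has_sum s) (range g)"
    by (rule has_sum_cong_neutral) (use assms in auto)
  then show ?thesis
    using has_sum_reindex[OF assms(1), of f s] by (simp add: o_def)
qed

lemma summable_on_extend: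
  assumes "inj g" "\<And>x. x \<notin> range g \<Longrightarrow> f x = 0"
  shows "f summable_on UNIV \<longleftrightarrow> (\<lambda>k. f (g k)) summable_on UNIV"
  using has_sum_extend[of g f] assms by (simp add: summable_on_def)

lemma infsum_extend:
  assumes "inj g" "\<And>x. x \<notin> range g \<Longrightarrow> f x = 0"
  shows "infsum f UNIV = infsum (\<lambda>k. f (g k)) UNIV"
  using has_sum_extend[of g f] summable_on_extend[of g f] assms by (simp add: infsum_def Topological_Spaces.Lim_def has_sum_def)

lemma infsum_eq_suminf:
  fixes f :: "nat \<Rightarrow> real"
  assumes "summable (\<lambda>n. norm (f n))"
  shows "infsum f UNIV = suminf f"
  using norm_summable_imp_has_sum[OF assms] summable_norm_cancel[OF assms]
  by (simp add: infsumI summable_sums)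

section \<open>Perturbing a substochastic matrix along a flow\<close>

lemma substochasticD:
  assumes "substochastic A"
  shows "0 \<le> A m k" "summable (A m)" "suminf (A m) \<le> 1" "summable (\<lambda>m. A m k)" "(\<Sum>m. A m k) \<le> 1"
  using assms by (auto simp: substochastic_def)

lemma substochastic_row_add:
  assumes A: "substochastic A" and "k \<noteq> k'"
  shows "A m k + A m k' \<le> 1"
proof -
  have "sum (A m) {k, k'} \<le> suminf (A m)"
    using substochasticD[OF A] by (intro sum_le_suminf) auto
  then show ?thesis using assms(2) substochasticD(3)[OF A, of m] by simp
qed

lemma substochastic_transpose: "substochastic A \<Longrightarrow> substochastic (\<lambda>m k. A k m)"
  by (simp add: substochastic_def)

lemma summable_dominated:
  fixes B :: "nat \<Rightarrow> real"
  assumes "summable A" "\<And>k. \<bar>B k\<bar> \<le> A k"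
  shows "summable (\<lambda>k. \<bar>B k\<bar>)" "summable B"
proof -
  show "summable (\<lambda>k. \<bar>B k\<bar>)"
    by (rule summable_comparison_test'[OF assms(1)]) (simp add: assms(2))
  then show "summable B" by (rule summable_rabs_cancel)
qed

text \<open>\<open>B\<close> is the small flow read from rows (\<open>Inl\<close>) to columns
  (\<open>Inr\<close>). A column vertex sees \<open>- B\<close> by antisymmetry, a sign that the
  absolute values absorb.\<close>

lemma substochastic_perturbation:
  assumes A: "substochastic A" and frac: "0 < A m0 k0" "A m0 k0 < 1"
  obtains B where "\<And>m k. \<bar>B m k\<bar> \<le> A m k" and "\<exists>m k. B m k \<noteq> 0"
    and "\<And>m. \<bar>suminf (B m)\<bar> \<le> 1 - suminf (A m)"
    and "\<And>k. \<bar>\<Sum>m. B m k\<bar> \<le> 1 - (\<Sum>m. A m k)"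
proof -
  note AD = substochasticD[OF A]
  define w :: "nat + nat \<Rightarrow> nat + nat \<Rightarrow> real" where
    "w x y = (case x of Inl m \<Rightarrow> (case y of Inl _ \<Rightarrow> 0 | Inr k \<Rightarrow> A m k)
                      | Inr k \<Rightarrow> (case y of Inl m \<Rightarrow> A m k | Inr _ \<Rightarrow> 0))" for x y
  have w_simps [simp]: "w (Inl m) (Inr k) = A m k" "w (Inr k) (Inl m) = A m k"
    "w (Inl m) (Inl m') = 0" "w (Inr k) (Inr k') = 0" for m k m' k'
    by (simp_all add: w_def)
  have Inl_zero: "f x = 0" if "x \<notin> range Inr" "\<And>m. f (Inl m) = 0" for f :: "nat + nat \<Rightarrow> real" and x
    using that by (cases x) auto
  have Inr_zero: "f x = 0" if "x \<notin> range Inl" "\<And>m. f (Inr m) = 0" for f :: "nat + nat \<Rightarrow> real" and x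
    using that by (cases x) auto
  have inf_row: "infsum f UNIV = infsum (\<lambda>k. f (Inr k)) UNIV"
    if "\<And>m. f (Inl m) = 0" for f :: "nat + nat \<Rightarrow> real"
    using that Inl_zero by (intro infsum_extend) auto
  have inf_col: "infsum f UNIV = infsum (\<lambda>k. f (Inl k)) UNIV"
    if "\<And>m. f (Inr m) = 0" for f :: "nat + nat \<Rightarrow> real"
    using that Inr_zero by (intro infsum_extend) auto
  have rowA: "infsum (w (Inl m)) UNIV = suminf (A m)" for m
    using inf_row[of "w (Inl m)"] AD by (simp add: infsum_eq_suminf)
  have colA: "infsum (w (Inr k)) UNIV = (\<Sum>m. A m k)" for k
    using inf_col[of "w (Inr k)"] AD by (simp add: infsum_eq_suminf)
  interpret fractional_edge w "Inl m0" "Inr k0"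
  proof
    show "w x y = w y x" for x y by (cases x; cases y) auto
    show "0 \<le> w x y" for x y by (cases x; cases y) (auto simp: AD)
    show "w x x = 0" for x by (cases x) auto
    show "w x summable_on UNIV" for x
    proof (cases x)
      case (Inl m)
      have "w x summable_on UNIV \<longleftrightarrow> (\<lambda>k. w x (Inr k)) summable_on UNIV"
        by (rule summable_on_extend[OF inj_Inr], erule Inl_zero) (simp add: Inl)
      then show ?thesis using AD by (simp add: Inl summable_nonneg_imp_summable_on)
    next
      case (Inr k)
      have "w x summable_on UNIV \<longleftrightarrow> (\<lambda>k. w x (Inl k)) summable_on UNIV"
        by (rule summable_on_extend[OF inj_Inl], erule Inr_zero) (simp add: Inr)
      then show ?thesis using AD by (simp add: Inr summable_nonneg_imp_summable_on)
    qed
    show "infsum (w x) UNIV \<le> 1" for x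
      using rowA colA AD by (cases x) auto
    show "0 < w (Inl m0) (Inr k0)" "w (Inl m0) (Inr k0) < 1" using frac by auto
  qed
  obtain \<theta> where anti: "\<And>x y. \<theta> y x = - \<theta> x y" and le: "\<And>x y. \<bar>\<theta> x y\<bar> \<le> w x y"
    and nz: "\<exists>x y. \<theta> x y \<noteq> 0" and bal: "\<And>x. \<bar>infsum (\<theta> x) UNIV\<bar> \<le> 1 - infsum (w x) UNIV"
    using small_flow_exists unfolding small_flow_def by metis
  \<comment> \<open>Domination by \<open>w\<close> forbids flow between two rows or two
    columns.\<close>
  have same [simp]: "\<theta> (Inl m) (Inl m') = 0" "\<theta> (Inr k) (Inr k') = 0" for m m' k k'
    using le[of "Inl m" "Inl m'"] le[of "Inr k" "Inr k'"] by auto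
  define B where "B m k = \<theta> (Inl m) (Inr k)" for m k
  have B: "\<theta> (Inl m) = (\<lambda>y. case y of Inl _ \<Rightarrow> 0 | Inr k \<Rightarrow> B m k)"
    "\<theta> (Inr k) = (\<lambda>y. case y of Inl m \<Rightarrow> - B m k | Inr _ \<Rightarrow> 0)" for m k
    using anti[of "Inr k" "Inl _"] by (auto simp: fun_eq_iff B_def split: sum.split)
  have BA: "\<bar>B m k\<bar> \<le> A m k" for m k
    using le[of "Inl m" "Inr k"] by (simp add: B_def)
  show ?thesis
  proof (rule that)
    obtain x y where "\<theta> x y \<noteq> 0" using nz by blast
    then show "\<exists>m k. B m k \<noteq> 0"
      by (cases x; cases y) (auto simp: B)
    show "\<bar>suminf (B m)\<bar> \<le> 1 - suminf (A m)" for m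
    proof -
      have "infsum (\<theta> (Inl m)) UNIV = suminf (B m)"
        using inf_row[of "\<theta> (Inl m)"] summable_dominated(1)[OF AD(2) BA]
        by (simp add: infsum_eq_suminf B)
      then show ?thesis using bal[of "Inl m"] rowA by simp
    qed
    show "\<bar>\<Sum>m. B m k\<bar> \<le> 1 - (\<Sum>m. A m k)" for k
    proof -
      have sm: "summable (\<lambda>m. \<bar>B m k\<bar>)"
        by (rule summable_dominated(1)[OF AD(4) BA])
      have "infsum (\<theta> (Inr k)) UNIV = (\<Sum>m. - B m k)"
        using inf_col[of "\<theta> (Inr k)"] sm
        by (simp add: infsum_eq_suminf B)
      also have "\<dots> = - (\<Sum>m. B m k)"
        using suminf_minus[OF summable_rabs_cancel[OF sm]] .
      finally show ?thesis using bal[of "Inr k"] colA by simp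
    qed
  qed (rule BA)
qed

section \<open>Doubly stochastic and substochastic operators through their real matrices\<close>

lemma of_real_suminf_le_1:
  "summable (\<lambda>k. complex_of_real (g k)) \<and> (\<Sum>k. complex_of_real (g k)) \<le> 1
     \<longleftrightarrow> summable g \<and> suminf g \<le> 1"
  by (auto simp: summable_of_real_iff suminf_of_real[symmetric] less_eq_complex_def)

text \<open>In the order on \<open>complex\<close> a nonnegative entry is real, so taking real parts
  loses nothing.\<close>

lemma doubly_substochastic_iff:
  "a \<in> doubly_substochastic e \<longleftrightarrow> a \<in> bounded_ops \<and>
     (\<exists>A. substochastic A \<and> entry e a = (\<lambda>m k. of_real (A m k)))"
proof -
  have "a \<in> doubly_substochastic e \<longleftrightarrow> a \<in> bounded_ops \<and> substochastic A"
    if "entry e a = (\<lambda>m k. of_real (A m k))" for A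
    unfolding doubly_substochastic_def substochastic_def that mem_Collect_eq of_real_suminf_le_1
    by (simp add: less_eq_complex_def)
  moreover have "entry e a = (\<lambda>m k. of_real (Re (entry e a m k)))" if "a \<in> doubly_substochastic e"
    using that by (auto simp: doubly_substochastic_def less_eq_complex_def complex_eq_iff fun_eq_iff)
  ultimately show ?thesis by metis
qed

lemma of_real_sums_1: "(\<lambda>k. complex_of_real (g k)) sums 1 \<longleftrightarrow> g sums 1"
  using sums_of_real_iff[where 'a = complex, of g 1] by simp

lemma doubly_stochastic_iff:
  "a \<in> doubly_stochastic e \<longleftrightarrow> a \<in> bounded_ops \<and>
     (\<exists>A. substochastic A \<and> (\<forall>m. suminf (A m) = 1) \<and> (\<forall>k. (\<Sum>m. A m k) = 1) \<and>
       entry e a = (\<lambda>m k. of_real (A m k)))"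
proof -
  have "a \<in> doubly_stochastic e \<longleftrightarrow> a \<in> bounded_ops \<and>
      substochastic A \<and> (\<forall>m. suminf (A m) = 1) \<and> (\<forall>k. (\<Sum>m. A m k) = 1)"
    if "entry e a = (\<lambda>m k. of_real (A m k))" for A
    unfolding doubly_stochastic_def substochastic_def that mem_Collect_eq
      of_real_sums_1
    by (auto simp: less_eq_complex_def sums_iff)
  moreover have "entry e a = (\<lambda>m k. of_real (Re (entry e a m k)))" if "a \<in> doubly_stochastic e"
    using that by (auto simp: doubly_stochastic_def less_eq_complex_def complex_eq_iff fun_eq_iff)
  ultimately show ?thesis by metis
qed

lemma partial_permutations_iff:
  "a \<in> partial_permutations e \<longleftrightarrow> a \<in> doubly_substochastic e \<and> (\<forall>m k. entry e a m k \<in> {0, 1})"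
proof -
  have "\<forall>m k. 0 \<le> entry e a m k" if "\<forall>m k. entry e a m k \<in> {0, 1}"
  proof (intro allI)
    fix m k
    show "0 \<le> entry e a m k" using that[rule_format, of m k] by (auto simp: less_eq_complex_def)
  qed
  then show ?thesis
    unfolding partial_permutations_def doubly_substochastic_def mem_Collect_eq by argo
qed

lemma doubly_stochastic_subset: "doubly_stochastic e \<subseteq> doubly_substochastic e"
  by (auto simp: doubly_stochastic_iff doubly_substochastic_iff)

text \<open>By linearity the value at \<open>u\<close> is the mean of those at \<open>v1\<close> and
  \<open>v2\<close>; as neither exceeds the strict maximum at \<open>u\<close>, both attain
  it.\<close>

lemma wot_exposed_midpoint:
  assumes "u \<in> wot_exposed C" "C \<subseteq> bounded_ops" "v1 \<in> C" "v2 \<in> C"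
    and mid: "\<And>x. 2 *\<^sub>C u x = v1 x + v2 x"
  shows "v1 = u"
proof (rule ccontr)
  assume "v1 \<noteq> u"
  obtain f where f: "wot_functional f" and less: "\<And>v. v \<in> C - {u} \<Longrightarrow> Re (f v) < Re (f u)"
    and u: "u \<in> C"
    using assms(1) unfolding wot_exposed_def by blast
  have "2 * f u = f (\<lambda>x. 2 *\<^sub>C u x)"
    using f u assms(2) unfolding wot_functional_def by (metis subsetD)
  also have "\<dots> = f v1 + f v2"
    unfolding mid using f assms(2-4) unfolding wot_functional_def by blast
  finally have "2 * Re (f u) = Re (f v1) + Re (f v2)"
    by (metis Re_complex_of_real complex_eq_iff mult_2 plus_complex.sel(1))
  moreover have "Re (f v1) < Re (f u)" using less \<open>v1 \<noteq> u\<close> assms(3) by blast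
  moreover have "Re (f v2) \<le> Re (f u)" using less[of v2] assms(4) by (cases "v2 = u") auto
  ultimately show False by simp
qed

text \<open>Hypothesis \<open>closed\<close> serves both sets at once: \<open>C\<close> must contain
  operators whose row and column sums differ from those of \<open>u\<close> by at most the deficit
  from 1. If an entry were fractional, \<open>A + B\<close> and \<open>A - B\<close> would give two
  such operators with midpoint \<open>u\<close>.\<close>

lemma wot_exposed_entry:
  fixes e :: "nat \<Rightarrow> 'a::complex_hilbert"
  assumes e: "orthonormal_basis e" and u: "u \<in> wot_exposed C" and C: "C \<subseteq> bounded_ops"
    and A: "substochastic A" "\<And>m k. entry e u m k = of_real (A m k)"
    and closed: "\<And>v A'. \<lbrakk>v \<in> bounded_ops; substochastic A'; \<And>m k. entry e v m k = of_real (A' m k);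
        \<And>m. \<bar>suminf (A' m) - suminf (A m)\<bar> \<le> 1 - suminf (A m);
        \<And>k. \<bar>(\<Sum>m. A' m k) - (\<Sum>m. A m k)\<bar> \<le> 1 - (\<Sum>m. A m k)\<rbrakk> \<Longrightarrow> v \<in> C"
  shows "A m k \<in> {0, 1}"
proof (rule ccontr)
  assume "A m k \<notin> {0, 1}"
  then have "0 < A m k" "A m k < 1"
    using substochasticD(1)[OF A(1), of m k] substochastic_le_1[OF A(1), of m k] by auto
  then obtain B where BA: "\<And>m k. \<bar>B m k\<bar> \<le> A m k" and nz: "\<exists>m k. B m k \<noteq> 0"
    and Br: "\<And>m. \<bar>suminf (B m)\<bar> \<le> 1 - suminf (A m)"
    and Bc: "\<And>k. \<bar>\<Sum>m. B m k\<bar> \<le> 1 - (\<Sum>m. A m k)"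
    using substochastic_perturbation[OF A(1)] by blast
  note AD = substochasticD[OF A(1)]
  have sB: "summable (B m)" "summable (\<lambda>m. B m k)" for m k
    using summable_dominated(2)[OF AD(2) BA] summable_dominated(2)[OF AD(4) BA] by auto
  have "\<exists>v\<in>C. \<forall>m k. entry e v m k = of_real (A m k + s * B m k)" if s: "s = 1 \<or> s = -1" for s :: real
  proof -
    let ?A = "\<lambda>m k. A m k + s * B m k"
    have abs_s: "\<bar>s * t\<bar> = \<bar>t\<bar>" for t using s by auto
    have row: "suminf (?A m) = suminf (A m) + s * suminf (B m)" for m
      using suminf_add[OF AD(2) summable_mult[OF sB(1)]] suminf_mult[OF sB(1)] by metis
    have col: "(\<Sum>m. ?A m k) = (\<Sum>m. A m k) + s * (\<Sum>m. B m k)" for k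
      using suminf_add[OF AD(4) summable_mult[OF sB(2)]] suminf_mult[OF sB(2)] by metis
    have "substochastic ?A"
      unfolding substochastic_def row col
    proof (intro conjI allI)
      show "0 \<le> ?A m k" for m k
        using BA[of m k] abs_s[of "B m k"] by linarith
      show "summable (?A m)" for m
        by (intro summable_add summable_mult AD sB)
      show "summable (\<lambda>m. ?A m k)" for k
        by (intro summable_add summable_mult AD sB)
      show "suminf (A m) + s * suminf (B m) \<le> 1" for m
        using Br[of m] abs_s[of "suminf (B m)"] by linarith
      show "(\<Sum>m. A m k) + s * (\<Sum>m. B m k) \<le> 1" for k
        using Bc[of k] abs_s[of "\<Sum>m. B m k"] by linarith
    qed
    moreover from substochastic_operator[OF e this] obtain v
      where "v \<in> bounded_ops" "\<And>m k. entry e v m k = of_real (?A m k)" by blast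
    ultimately have "v \<in> C"
      using Br Bc by (intro closed[of v ?A]) (simp_all add: row col abs_s)
    then show ?thesis using \<open>\<And>m k. entry e v m k = of_real (?A m k)\<close> by blast
  qed
  from this[of 1] this[of "-1"] obtain v1 v2 where v: "v1 \<in> C" "v2 \<in> C"
    and v1: "\<And>m k. entry e v1 m k = of_real (A m k + B m k)"
    and v2: "\<And>m k. entry e v2 m k = of_real (A m k - B m k)" by auto
  have uC: "u \<in> C" using u by (simp add: wot_exposed_def)
  have bl: "bounded_linear u" "bounded_linear v1" "bounded_linear v2"
    using uC v C by (auto intro: bounded_opsD)
  have hom: "u (c *\<^sub>C x) = c *\<^sub>C u x" "v1 (c *\<^sub>C x) = c *\<^sub>C v1 x" "v2 (c *\<^sub>C x) = c *\<^sub>C v2 x" for c x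
    using uC v C by (auto intro: bounded_opsD)
  have "(\<lambda>x. u x + u x) = (\<lambda>x. v1 x + v2 x)"
  proof (rule entry_eqI[OF e])
    show "(\<lambda>x. u x + u x) \<in> bounded_ops" "(\<lambda>x. v1 x + v2 x) \<in> bounded_ops"
      using bl by (auto simp: bounded_ops_def hom scaleC_add_right intro: bounded_linear_add)
    show "entry e (\<lambda>x. u x + u x) m k = entry e (\<lambda>x. v1 x + v2 x) m k" for m k
      using A(2)[of m k] v1[of m k] v2[of m k] by (simp add: entry_def cinner_add_left)
  qed
  moreover have "2 *\<^sub>C u x = u x + u x" for x
    using scaleC_add_left[of 1 1 "u x"] by simp
  ultimately have "v1 = u"
    by (intro wot_exposed_midpoint[OF u C v]) (metis (no_types))
  then have "B m k = 0" for m k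
    using A(2)[of m k] v1[of m k] by simp
  with nz show False by blast
qed

section \<open>Exposing functionals\<close>

lemma wot_continuous_cinner:
  "continuous_map weak_operator_topology euclidean (\<lambda>a. cinner (a x) y)"
proof -
  have "continuous_on UNIV (\<lambda>F :: 'a \<Rightarrow> 'a \<Rightarrow> complex. F x y)"
    by (rule continuous_on_product_then_coordinatewise[OF continuous_on_product_coordinates])
  then have "continuous_map euclidean euclidean (\<lambda>F :: 'a \<Rightarrow> 'a \<Rightarrow> complex. F x y)"
    by simp
  from continuous_map_pullback[OF this, of bounded_ops "\<lambda>a x y. cinner (a x) y"]
  show ?thesis by (simp add: weak_operator_topology_def o_def)
qed

lemma wot_functional_cinner_diff:
  "wot_functional (\<lambda>a. cinner (a x) y - cinner (a x') y')"
  unfolding wot_functional_def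
proof (intro conjI ballI allI)
  show "continuous_map weak_operator_topology euclidean (\<lambda>a. cinner (a x) y - cinner (a x') y')"
    by (intro continuous_map_diff wot_continuous_cinner)
qed (simp_all add: cinner_add_left cinner_scaleC_left algebra_simps)

lemma has_sum_onb_absolute:
  fixes e :: "nat \<Rightarrow> 'a::complex_hilbert"
  assumes e: "orthonormal_basis e" and \<xi>: "summable (\<lambda>k. \<bar>\<xi> k\<bar>)"
  shows "\<exists>x. ((\<lambda>k. \<xi> k *\<^sub>R e k) has_sum x) UNIV"
proof -
  have "summable (\<lambda>k. norm (\<xi> k *\<^sub>R e k))"
    using \<xi> by (simp add: norm_onb[OF e])
  from norm_summable_imp_has_sum[OF this summable_sums[OF summable_norm_cancel[OF this]]]
  show ?thesis by (rule exI)
qed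

lemma abs_summable_on_product:
  fixes \<xi> \<eta> :: "nat \<Rightarrow> real"
  assumes "summable (\<lambda>k. \<bar>\<xi> k\<bar>)" "summable (\<lambda>m. \<bar>\<eta> m\<bar>)"
  shows "(\<lambda>(k, m). \<bar>\<xi> k\<bar> * \<bar>\<eta> m\<bar>) summable_on UNIV \<times> UNIV"
proof (rule summable_on_SigmaI)
  have "(\<lambda>m. \<bar>\<eta> m\<bar>) summable_on UNIV" "(\<lambda>k. \<bar>\<xi> k\<bar>) summable_on UNIV"
    using assms by (auto intro: summable_nonneg_imp_summable_on)
  then show "((\<lambda>m. case (k, m) of (k, m) \<Rightarrow> \<bar>\<xi> k\<bar> * \<bar>\<eta> m\<bar>) has_sum \<bar>\<xi> k\<bar> * infsum (\<lambda>m. \<bar>\<eta> m\<bar>) UNIV) UNIV"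
    and "(\<lambda>k. \<bar>\<xi> k\<bar> * infsum (\<lambda>m. \<bar>\<eta> m\<bar>) UNIV) summable_on UNIV" for k
    by (auto intro: has_sum_cmult_right summable_on_cmult_left)
qed auto

text \<open>Expanding \<open>y\<close> and then \<open>x\<close> gives an iterated sum; bounded
  entries and absolutely summable coefficients turn it into an unordered sum over index
  pairs.\<close>

lemma cinner_rank_one:
  fixes e :: "nat \<Rightarrow> 'a::complex_hilbert"
  assumes a: "a \<in> bounded_ops" and ent: "entry e a = (\<lambda>m k. of_real (A m k))"
    and A1: "\<And>m k. \<bar>A m k\<bar> \<le> 1"
    and x: "((\<lambda>k. \<xi> k *\<^sub>R e k) has_sum x) UNIV" and y: "((\<lambda>m. \<eta> m *\<^sub>R e m) has_sum y) UNIV"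
    and \<xi>: "summable (\<lambda>k. \<bar>\<xi> k\<bar>)" and \<eta>: "summable (\<lambda>m. \<bar>\<eta> m\<bar>)"
  shows "((\<lambda>(k, m). \<xi> k * \<eta> m * A m k) has_sum Re (cinner (a x) y)) (UNIV \<times> UNIV)"
proof -
  interpret a: bounded_linear a by (rule bounded_opsD[OF a])
  let ?f = "\<lambda>(k, m). \<xi> k * \<eta> m * A m k"
  have inner: "((\<lambda>m. ?f (k, m)) has_sum \<xi> k * Re (cinner (a (e k)) y)) UNIV" for k
  proof -
    have "((\<lambda>m. cinner (a (e k)) (\<eta> m *\<^sub>R e m)) has_sum cinner (a (e k)) y) UNIV"
      by (rule has_sum_bounded_linear[OF bounded_linear_cinner_right y])
    moreover have "cinner (a (e k)) (\<eta> m *\<^sub>R e m) = of_real (\<eta> m * A m k)" for m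
      using fun_cong[OF fun_cong[OF ent], of m k]
      by (simp add: entry_def cinner_scaleC_right flip: scaleC_of_real)
    ultimately have "((\<lambda>m. complex_of_real (\<eta> m * A m k)) has_sum cinner (a (e k)) y) UNIV"
      by simp
    from has_sum_cmult_right[OF has_sum_Re[OF this], of "\<xi> k"]
    show ?thesis by (simp add: mult.assoc)
  qed
  have "((\<lambda>k. Re (cinner (a (\<xi> k *\<^sub>R e k)) y)) has_sum Re (cinner (a x) y)) UNIV"
    by (intro has_sum_Re has_sum_bounded_linear[OF bounded_linear_cinner_left]
        has_sum_bounded_linear[OF a.bounded_linear_axioms] x)
  then have outer: "((\<lambda>k. \<xi> k * Re (cinner (a (e k)) y)) has_sum Re (cinner (a x) y)) UNIV"
    by (simp add: a.scaleR cinner_scaleR_left)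
  have "(\<lambda>p. norm (?f p)) summable_on UNIV \<times> UNIV"
  proof (rule summable_on_comparison_test[OF abs_summable_on_product[OF \<xi> \<eta>]])
    fix p :: "nat \<times> nat"
    obtain k m where "p = (k, m)" by fastforce
    then show "norm (?f p) \<le> (case p of (k, m) \<Rightarrow> \<bar>\<xi> k\<bar> * \<bar>\<eta> m\<bar>)"
      using mult_left_mono[OF A1[of m k], of "\<bar>\<xi> k\<bar> * \<bar>\<eta> m\<bar>"] by (simp add: abs_mult)
  qed auto
  then have "?f summable_on UNIV \<times> UNIV" by (rule Infinite_Sum.abs_summable_summable)
  from has_sum_SigmaI[OF inner outer this] show ?thesis .
qed

section \<open>Linear programming duality over substochastic matrices\<close>

lemma has_sum_potential:
  assumes A: "substochastic A" and \<alpha>: "\<And>k. 0 \<le> \<alpha> k" "summable \<alpha>"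
  shows "((\<lambda>(k, m). \<alpha> k * A m k) has_sum (\<Sum>\<^sub>\<infinity>k. \<alpha> k * (\<Sum>m. A m k))) (UNIV \<times> UNIV)"
    and "(\<lambda>k. \<alpha> k * (\<Sum>m. A m k)) summable_on UNIV"
proof -
  have A0: "0 \<le> A m k" and Ac: "summable (\<lambda>m. A m k)" "(\<Sum>m. A m k) \<le> 1" for m k
    using A by (auto simp: substochastic_def)
  have inner: "((\<lambda>m. case (k, m) of (k, m) \<Rightarrow> \<alpha> k * A m k) has_sum \<alpha> k * (\<Sum>m. A m k)) UNIV" for k
    using has_sum_cmult_right[OF sums_nonneg_imp_has_sum[OF summable_sums[OF Ac(1)] A0]] by simp
  show sm: "(\<lambda>k. \<alpha> k * (\<Sum>m. A m k)) summable_on UNIV"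
  proof (rule summable_on_comparison_test)
    show "\<alpha> summable_on UNIV"
      using \<alpha> by (simp add: summable_nonneg_imp_summable_on)
    show "\<alpha> k * (\<Sum>m. A m k) \<le> \<alpha> k" for k
      using mult_left_mono[OF Ac(2) \<alpha>(1), of k k] by simp
    show "0 \<le> \<alpha> k * (\<Sum>m. A m k)" for k
      by (intro mult_nonneg_nonneg \<alpha> suminf_nonneg Ac A0)
  qed
  have "(\<lambda>(k, m). \<alpha> k * A m k) summable_on UNIV \<times> UNIV"
    by (rule summable_on_SigmaI[OF inner sm]) (simp add: \<alpha> A0)
  from has_sum_SigmaI[OF inner has_sum_infsum[OF sm] this]
  show "((\<lambda>(k, m). \<alpha> k * A m k) has_sum (\<Sum>\<^sub>\<infinity>k. \<alpha> k * (\<Sum>m. A m k))) (UNIV \<times> UNIV)" .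
qed

text \<open>The row part is the column statement for the transposed matrix with index pairs
  swapped.\<close>

lemma has_sum_potentials:
  assumes A: "substochastic A" and \<alpha>: "\<And>k. 0 \<le> \<alpha> k" "summable \<alpha>" and \<beta>: "\<And>m. 0 \<le> \<beta> m" "summable \<beta>"
  shows "((\<lambda>(k, m). (\<alpha> k + \<beta> m) * A m k) has_sum
    (\<Sum>\<^sub>\<infinity>k. \<alpha> k * (\<Sum>m. A m k)) + (\<Sum>\<^sub>\<infinity>m. \<beta> m * (\<Sum>k. A m k))) (UNIV \<times> UNIV)"
proof -
  have "substochastic (\<lambda>m k. A k m)" using A by (simp add: substochastic_def)
  from has_sum_potential(1)[OF this \<beta>]
  have "((\<lambda>(k, m). \<beta> m * A m k) has_sum (\<Sum>\<^sub>\<infinity>m. \<beta> m * (\<Sum>k. A m k))) (UNIV \<times> UNIV)"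
    by (subst has_sum_swap) simp
  from has_sum_add[OF has_sum_potential(1)[OF A \<alpha>] this]
  show ?thesis by (simp add: case_prod_unfold distrib_right)
qed

text \<open>Complementary slackness: \<open>\<alpha>\<close>, \<open>\<beta>\<close> are an optimal dual solution
  certifying that \<open>P\<close> maximises the objective \<open>c\<close>.\<close>

lemma unique_maximiser:
  assumes A: "substochastic A" and P: "substochastic P" and P01: "\<And>m k. P m k \<in> {0, 1}"
    and \<alpha>: "\<And>k. 0 \<le> \<alpha> k" "summable \<alpha>" and \<beta>: "\<And>m. 0 \<le> \<beta> m" "summable \<beta>"
    and off: "\<And>m k. P m k = 0 \<Longrightarrow> c k m < \<alpha> k + \<beta> m"
    and on: "\<And>m k. P m k = 1 \<Longrightarrow> c k m = \<alpha> k + \<beta> m \<and> 0 < \<alpha> k"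
    and supp: "\<And>k. 0 < \<alpha> k \<Longrightarrow> (\<Sum>m. P m k) = 1" "\<And>m. 0 < \<beta> m \<Longrightarrow> (\<Sum>k. P m k) = 1"
    and FA: "((\<lambda>(k, m). c k m * A m k) has_sum FA) (UNIV \<times> UNIV)"
    and FP: "((\<lambda>(k, m). c k m * P m k) has_sum FP) (UNIV \<times> UNIV)"
    and le: "FP \<le> FA"
  shows "A = P"
proof -
  have A0: "0 \<le> A m k" and Ac: "summable (\<lambda>m. A m k)" "(\<Sum>m. A m k) \<le> 1"
    and Ar: "summable (A m)" "suminf (A m) \<le> 1" for m k
    using A by (auto simp: substochastic_def)
  have At: "substochastic (\<lambda>m k. A k m)" using A by (simp add: substochastic_def)
  define a where "a = (\<Sum>\<^sub>\<infinity>k. \<alpha> k * (\<Sum>m. A m k))"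
  define b where "b = (\<Sum>\<^sub>\<infinity>m. \<beta> m * (\<Sum>k. A m k))"
  have \<alpha>s: "\<alpha> summable_on UNIV" and \<beta>s: "\<beta> summable_on UNIV"
    using \<alpha> \<beta> by (simp_all add: summable_nonneg_imp_summable_on)
  have "FP = (\<Sum>\<^sub>\<infinity>k. \<alpha> k * (\<Sum>m. P m k)) + (\<Sum>\<^sub>\<infinity>m. \<beta> m * (\<Sum>k. P m k))"
  proof (rule has_sum_unique[OF FP])
    have eq: "c k m * P m k = (\<alpha> k + \<beta> m) * P m k" for k m
      using P01[of m k] on[of m k] by auto
    show "((\<lambda>(k, m). c k m * P m k) has_sum
        (\<Sum>\<^sub>\<infinity>k. \<alpha> k * (\<Sum>m. P m k)) + (\<Sum>\<^sub>\<infinity>m. \<beta> m * (\<Sum>k. P m k))) (UNIV \<times> UNIV)"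
      unfolding eq by (rule has_sum_potentials[OF P \<alpha> \<beta>])
  qed
  \<comment> \<open>Where a potential is positive the corresponding sum of \<open>P\<close> is 1;
    elsewhere both sides vanish.\<close>
  also have "(\<lambda>k. \<alpha> k * (\<Sum>m. P m k)) = \<alpha>"
    using supp(1) \<alpha>(1) by (force simp: fun_eq_iff order_le_less)
  also have "(\<lambda>m. \<beta> m * (\<Sum>k. P m k)) = \<beta>"
    using supp(2) \<beta>(1) by (force simp: fun_eq_iff order_le_less)
  finally have FP_eq: "FP = infsum \<alpha> UNIV + infsum \<beta> UNIV" .
  have b_le: "b \<le> infsum \<beta> UNIV"
    unfolding b_def
  proof (rule infsum_mono[OF has_sum_potential(2)[OF At \<beta>] \<beta>s])
    show "\<beta> m * (\<Sum>k. A m k) \<le> \<beta> m" for m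
      using mult_left_mono[OF Ar(2) \<beta>(1), of m m] by simp
  qed
  have "((\<lambda>k. \<alpha> k + - (\<alpha> k * (\<Sum>m. A m k))) has_sum infsum \<alpha> UNIV + - a) UNIV"
    unfolding a_def
    by (intro has_sum_add has_sum_uminusI has_sum_infsum \<alpha>s has_sum_potential(2)[OF A \<alpha>])
  then have a_sum: "((\<lambda>k. \<alpha> k * (1 - (\<Sum>m. A m k))) has_sum infsum \<alpha> UNIV - a) UNIV"
    by (simp add: algebra_simps)
  have a_nonneg: "0 \<le> \<alpha> k * (1 - (\<Sum>m. A m k))" for k
    using \<alpha>(1) Ac(2) by simp
  have a_le: "a \<le> infsum \<alpha> UNIV"
    using has_sum_nonneg[OF a_sum] a_nonneg by simp
  have "((\<lambda>p. (\<lambda>(k, m). (\<alpha> k + \<beta> m) * A m k) p + - (\<lambda>(k, m). c k m * A m k) p)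
      has_sum (a + b) + - FA) (UNIV \<times> UNIV)"
    unfolding a_def b_def
    by (intro has_sum_add has_sum_uminusI FA has_sum_potentials A \<alpha> \<beta>)
  then have slack: "((\<lambda>(k, m). (\<alpha> k + \<beta> m - c k m) * A m k) has_sum a + b - FA) (UNIV \<times> UNIV)"
    by (simp add: case_prod_unfold algebra_simps)
  have c_le: "0 \<le> \<alpha> k + \<beta> m - c k m" for k m
    using P01[of m k] on[of m k] off[of m k] by auto
  have slack_nonneg: "0 \<le> (\<lambda>(k, m). (\<alpha> k + \<beta> m - c k m) * A m k) p" for p
    using c_le A0 by (auto split: prod.split)
  \<comment> \<open>The chain \<open>FA \<le> a + b \<le> infsum \<alpha> UNIV + infsum \<beta> UNIV
    = FP \<le> FA\<close> collapses to equalities, so each sum of nonnegative slacks is zero term by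
    term.\<close>
  have "a + b - FA \<le> 0" "infsum \<alpha> UNIV - a \<le> 0"
    using le FP_eq b_le a_le has_sum_nonneg[OF slack slack_nonneg] by auto
  then have zero: "(\<alpha> k + \<beta> m - c k m) * A m k = 0" and full: "\<alpha> k * (1 - (\<Sum>m. A m k)) = 0" for k m
    using nonneg_has_sum_le_0D[OF slack _ slack_nonneg, of "(k, m)"]
      nonneg_has_sum_le_0D[OF a_sum _ a_nonneg, of k] by auto
  have A_off: "A m k = 0" if "P m k = 0" for m k
    using zero[of k m] off[OF that] by auto
  show "A = P"
  proof (intro ext)
    fix m k
    show "A m k = P m k"
    proof (cases "P m k = 0")
      case False
      then have P1: "P m k = 1" using P01[of m k] by auto
      have "P m' k = 0" if "m' \<noteq> m" for m'
      proof -
        have "sum (\<lambda>m. P m k) {m, m'} \<le> (\<Sum>m. P m k)"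
          using P by (intro sum_le_suminf) (auto simp: substochastic_def)
        also have "\<dots> \<le> 1" using P by (simp add: substochastic_def)
        finally show ?thesis using that P1 P01[of m' k] by auto
      qed
      \<comment> \<open>Since \<open>A\<close> vanishes where \<open>P\<close> does, column
        \<open>k\<close> keeps only the entry at \<open>m\<close>; as \<open>\<alpha> k\<close> is
        positive, \<open>full\<close> forces that entry to be 1.\<close>
      then have "(\<Sum>m. A m k) = A m k"
        using A_off by (subst suminf_finite[of "{m}"]) auto
      then show ?thesis using full[of k] on[OF P1] P1 by auto
    qed (simp add: A_off)
  qed
qed

lemma partial_permutation_exposed:
  fixes e :: "nat \<Rightarrow> 'a::complex_hilbert"
  assumes e: "orthonormal_basis e" and u: "u \<in> partial_permutations e"
  shows "u \<in> wot_exposed (doubly_substochastic e)"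
proof -
  have uD: "u \<in> doubly_substochastic e" and u01: "\<And>m k. entry e u m k \<in> {0, 1}"
    using u unfolding partial_permutations_iff by auto
  then obtain P where P: "substochastic P" and entu: "entry e u = (\<lambda>m k. of_real (P m k))"
    and uB: "u \<in> bounded_ops"
    unfolding doubly_substochastic_iff by blast
  have P01: "P m k \<in> {0, 1}" for m k
    using u01[of m k] unfolding entu by auto
  define K where "K = {k. \<exists>m. P m k = 1}"
  define M where "M = {m. \<exists>k. P m k = 1}"
  \<comment> \<open>The column matched to row \<open>m\<close>; arbitrary for \<open>m\<close>
    outside \<open>M\<close>, where the coefficients below do not refer to it.\<close>
  define \<kappa> where "\<kappa> m = (SOME k. P m k = 1)" for m
  define t :: "nat \<Rightarrow> real" where "t k = (1/2) ^ k" for k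
  have t0: "0 < t k" for k by (simp add: t_def)
  have t1: "t k \<le> 1" for k by (simp add: t_def power_le_one)
  have t_inj: "t k = t k' \<longleftrightarrow> k = k'" for k k'
    by (simp add: t_def power_inject_exp')
  have "t = (\<lambda>k. (1/2) ^ k)" by (simp add: fun_eq_iff t_def)
  then have ts: "summable t" by (simp add: summable_geometric)
  have t_sum: "t summable_on UNIV"
    using ts t0 by (intro summable_nonneg_imp_summable_on) (auto simp: less_imp_le)
  have \<kappa>: "P m (\<kappa> m) = 1" if "m \<in> M" for m
    using that unfolding M_def \<kappa>_def by (auto intro: someI)
  have \<kappa>_eq: "k = \<kappa> m" if "P m k = 1" for m k
  proof (rule ccontr)
    assume "k \<noteq> \<kappa> m"
    moreover have "m \<in> M" using that by (auto simp: M_def)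
    ultimately show False
      using substochastic_row_add[OF P, of k "\<kappa> m" m] that \<kappa> by simp
  qed
  have \<kappa>_inj: "inj_on \<kappa> M"
  proof (rule inj_onI, rule ccontr)
    fix m m' assume "m \<in> M" "m' \<in> M" "\<kappa> m = \<kappa> m'" "m \<noteq> m'"
    then show False
      using substochastic_row_add[OF substochastic_transpose[OF P], of m m' "\<kappa> m"] \<kappa>[of m] \<kappa>[of m']
      by simp
  qed
  \<comment> \<open>The product \<open>\<xi> k * \<eta> m\<close> has the wanted sign except when
    \<open>k\<close> is outside \<open>K\<close> and \<open>m\<close> outside \<open>M\<close>,
    where two negatives give \<open>t k * t m\<close>. The second product lives on that block only,
    and its factor 2 turns the value into \<open>- (t k * t m)\<close>.\<close>
  define \<xi> where "\<xi> k = (if k \<in> K then t k else - t k)" for k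
  define \<xi>' where "\<xi>' k = (if k \<in> K then 0 else t k)" for k
  define \<eta> where "\<eta> m = (if m \<in> M then t (\<kappa> m) else - t m)" for m
  define \<eta>' where "\<eta>' m = (if m \<in> M then 0 else 2 * t m)" for m
  \<comment> \<open>The two terms of the arithmetic-geometric mean bound: on \<open>M\<close> and
    \<open>K\<close> the slack \<open>\<alpha> k + \<beta> m - c k m\<close> is
    \<open>(t k - t (\<kappa> m))\<^sup>2 / 2\<close>, zero only for matched pairs since
    \<open>t\<close> is injective.\<close>
  define \<alpha> where "\<alpha> k = (if k \<in> K then (t k)\<^sup>2 / 2 else 0)" for k
  define \<beta> where "\<beta> m = (if m \<in> M then (t (\<kappa> m))\<^sup>2 / 2 else 0)" for m
  define c where "c k m = \<xi> k * \<eta> m - \<xi>' k * \<eta>' m" for k m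
  have \<xi>s: "summable (\<lambda>k. \<bar>\<xi> k\<bar>)" "summable (\<lambda>k. \<bar>\<xi>' k\<bar>)"
    by (rule summable_comparison_test'[OF ts]; simp add: \<xi>_def \<xi>'_def t0 less_imp_le)+
  \<comment> \<open>By injectivity of \<open>\<kappa>\<close> on \<open>M\<close>, the values
    \<open>t (\<kappa> m)\<close> are terms of \<open>t\<close> without repetition.\<close>
  have "(\<lambda>m. \<bar>\<eta> m\<bar>) summable_on M"
  proof -
    have "t summable_on \<kappa> ` M" by (rule summable_on_subset[OF t_sum]) simp
    then have "(t \<circ> \<kappa>) summable_on M" by (simp add: summable_on_reindex[OF \<kappa>_inj])
    then show ?thesis
      by (rule summable_on_cong[THEN iffD1, rotated]) (simp add: \<eta>_def t0 less_imp_le)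
  qed
  moreover have "(\<lambda>m. \<bar>\<eta> m\<bar>) summable_on - M"
  proof -
    have "t summable_on - M" by (rule summable_on_subset[OF t_sum]) simp
    then show ?thesis
      by (rule summable_on_cong[THEN iffD1, rotated]) (simp add: \<eta>_def t0 less_imp_le)
  qed
  ultimately have "(\<lambda>m. \<bar>\<eta> m\<bar>) summable_on (M \<union> - M)"
    by (rule summable_on_Un_disjoint) simp
  then have \<eta>s: "summable (\<lambda>m. \<bar>\<eta> m\<bar>)"
    by (simp add: summable_on_imp_summable)
  have \<eta>'s: "summable (\<lambda>m. \<bar>\<eta>' m\<bar>)"
    by (rule summable_comparison_test'[OF summable_mult[OF ts, of 2]])
       (simp add: \<eta>'_def t0 less_imp_le)
  have \<alpha>: "0 \<le> \<alpha> k" "summable \<alpha>" for k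
  proof -
    show "0 \<le> \<alpha> k" for k by (simp add: \<alpha>_def)
    have "(t k)\<^sup>2 / 2 \<le> t k" for k
      using mult_mono[OF t1[of k] order_refl, of "t k"] t0[of k] by (simp add: power2_eq_square)
    then show "summable \<alpha>"
      by (intro summable_comparison_test'[OF ts, of 0]) (simp add: \<alpha>_def t0 less_imp_le)
  qed
  have \<beta>: "0 \<le> \<beta> m" "summable \<beta>" for m
  proof -
    show "0 \<le> \<beta> m" for m by (simp add: \<beta>_def)
    have "(t k)\<^sup>2 / 2 \<le> t k" for k
      using mult_mono[OF t1[of k] order_refl, of "t k"] t0[of k] by (simp add: power2_eq_square)
    then show "summable \<beta>"
      by (intro summable_comparison_test'[OF \<eta>s, of 0]) (simp add: \<beta>_def \<eta>_def t0 less_imp_le)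
  qed
  obtain x where x: "((\<lambda>k. \<xi> k *\<^sub>R e k) has_sum x) UNIV" using has_sum_onb_absolute[OF e \<xi>s(1)] by blast
  obtain x' where x': "((\<lambda>k. \<xi>' k *\<^sub>R e k) has_sum x') UNIV" using has_sum_onb_absolute[OF e \<xi>s(2)] by blast
  obtain y where y: "((\<lambda>m. \<eta> m *\<^sub>R e m) has_sum y) UNIV" using has_sum_onb_absolute[OF e \<eta>s] by blast
  obtain y' where y': "((\<lambda>m. \<eta>' m *\<^sub>R e m) has_sum y') UNIV" using has_sum_onb_absolute[OF e \<eta>'s] by blast
  define f where "f a = cinner (a x) y - cinner (a x') y'" for a
  have f_sum: "((\<lambda>(k, m). c k m * A m k) has_sum Re (f a)) (UNIV \<times> UNIV)"
    if "a \<in> bounded_ops" "substochastic A" "entry e a = (\<lambda>m k. of_real (A m k))" for a A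
  proof -
    have A1: "\<bar>A m k\<bar> \<le> 1" for m k
      using substochastic_le_1[OF that(2), of m k] substochasticD(1)[OF that(2), of m k] by simp
    note r = cinner_rank_one[OF that(1,3) A1]
    from has_sum_add[OF r[OF x y \<xi>s(1) \<eta>s] has_sum_uminusI[OF r[OF x' y' \<xi>s(2) \<eta>'s]]]
    show ?thesis by (simp add: f_def c_def case_prod_unfold algebra_simps)
  qed
  have K_sum: "(\<Sum>m. P m k) = 1" if "k \<in> K" for k
  proof (rule antisym)
    obtain m where m: "P m k = 1" using \<open>k \<in> K\<close> by (auto simp: K_def)
    have "sum (\<lambda>m. P m k) {m} \<le> (\<Sum>m. P m k)"
      using substochasticD[OF P] by (intro sum_le_suminf) auto
    then show "1 \<le> (\<Sum>m. P m k)" using m by simp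
  qed (rule substochasticD[OF P])
  have M_sum: "(\<Sum>k. P m k) = 1" if "m \<in> M" for m
  proof (rule antisym)
    have "sum (P m) {\<kappa> m} \<le> suminf (P m)"
      using substochasticD[OF P] by (intro sum_le_suminf) auto
    then show "1 \<le> suminf (P m)" using \<kappa>[OF that] by simp
  qed (rule substochasticD[OF P])
  have off: "c k m < \<alpha> k + \<beta> m" if "P m k = 0" for m k
  proof (cases "k \<in> K \<and> m \<in> M")
    case True
    then have "\<kappa> m \<noteq> k" using \<kappa>[of m] that by auto
    then have "0 < (t k - t (\<kappa> m))\<^sup>2" using t_inj[of k "\<kappa> m"] by simp
    then show ?thesis
      using True by (simp add: c_def \<alpha>_def \<beta>_def \<xi>_def \<xi>'_def \<eta>_def \<eta>'_def power2_diff field_simps)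
  next
    case False
    then have "c k m < 0"
      using mult_pos_pos[OF t0[of k] t0[of m]] mult_pos_pos[OF t0[of k] t0[of "\<kappa> m"]]
      by (auto simp: c_def \<xi>_def \<xi>'_def \<eta>_def \<eta>'_def)
    then show ?thesis using \<alpha>(1)[of k] \<beta>(1)[of m] by linarith
  qed
  have on: "c k m = \<alpha> k + \<beta> m \<and> 0 < \<alpha> k" if "P m k = 1" for m k
  proof -
    have "k \<in> K" "m \<in> M" "\<kappa> m = k" using that \<kappa>_eq by (auto simp: K_def M_def)
    then show ?thesis
      using t0[of k] by (simp add: c_def \<alpha>_def \<beta>_def \<xi>_def \<xi>'_def \<eta>_def \<eta>'_def power2_eq_square)
  qed
  have "Re (f v) < Re (f u)" if v: "v \<in> doubly_substochastic e - {u}" for v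
  proof (rule ccontr)
    assume "\<not> Re (f v) < Re (f u)"
    then have le: "Re (f u) \<le> Re (f v)" by simp
    obtain A where A: "substochastic A" "entry e v = (\<lambda>m k. of_real (A m k))" and vB: "v \<in> bounded_ops"
      using v doubly_substochastic_iff[of v e] by auto
    have "A = P"
    proof (rule unique_maximiser[OF A(1) P P01 \<alpha> \<beta> off on])
      show "(\<Sum>m. P m k) = 1" if "0 < \<alpha> k" for k
        using that by (intro K_sum) (auto simp: \<alpha>_def split: if_splits)
      show "suminf (P m) = 1" if "0 < \<beta> m" for m
        using that by (intro M_sum) (auto simp: \<beta>_def split: if_splits)
    qed (use f_sum[OF vB A] f_sum[OF uB P entu] le in auto)
    then have "v = u"
      using A(2) entu by (intro entry_eqI[OF e vB uB]) simp
    with v show False by simp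
  qed
  moreover have "wot_functional f"
    unfolding f_def by (rule wot_functional_cinner_diff)
  ultimately show ?thesis
    using uD unfolding wot_exposed_def by blast
qed

text \<open>The same functional exposes \<open>u\<close> in the smaller set; permutation operators
  thus inherit exposedness from the doubly substochastic case.\<close>

lemma wot_exposed_subset:
  assumes "u \<in> wot_exposed C" "C' \<subseteq> C" "u \<in> C'"
  shows "u \<in> wot_exposed C'"
  using assms unfolding wot_exposed_def by blast

section \<open>Permutation operators\<close>

lemma perm_op_eqI:
  fixes e :: "nat \<Rightarrow> 'a::complex_hilbert"
  assumes e: "orthonormal_basis e" and a: "a \<in> bounded_ops" "\<And>n. a (e n) = e (\<rho> n)"
  shows "perm_op e \<rho> = a"
  unfolding perm_op_def
proof (rule the_equality)
  show "b = a" if "b \<in> bounded_ops \<and> (\<forall>n. b (e n) = e (\<rho> n))" for b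
    using that a by (intro entry_eqI[OF e]) (auto simp: entry_def)
qed (use a in auto)

lemma of_bool_sums:
  assumes "\<And>k. Q k \<longleftrightarrow> k = n"
  shows "(\<lambda>k. of_bool (Q k) :: real) sums 1"
  using sums_single[of n "\<lambda>_. 1::real"] by (simp add: assms of_bool_def)

text \<open>The permutation matrix is substochastic and so defines a bounded operator, which is what
  the definite description in \<open>perm_op\<close> denotes.\<close>

lemma perm_op_doubly_stochastic:
  fixes e :: "nat \<Rightarrow> 'a::complex_hilbert"
  assumes e: "orthonormal_basis e" and \<rho>: "bij \<rho>"
  shows "perm_op e \<rho> \<in> doubly_stochastic e" "perm_op e \<rho> \<in> partial_permutations e"
proof -
  define A :: "nat \<Rightarrow> nat \<Rightarrow> real" where "A m k = of_bool (m = \<rho> k)" for m k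
  have row: "A m sums 1" for m
    unfolding A_def using \<rho>
    by (intro of_bool_sums[of _ "inv \<rho> m"]) (metis bij_inv_eq_iff)
  have col: "(\<lambda>m. A m k) sums 1" for k
    unfolding A_def by (intro of_bool_sums[of _ "\<rho> k"]) simp
  have sub: "substochastic A"
    using row col by (auto simp: substochastic_def sums_iff A_def)
  obtain a where a: "a \<in> bounded_ops" and ent: "\<And>m k. entry e a m k = of_real (A m k)"
    using substochastic_operator[OF e sub] by blast
  have "a (e k) = e (\<rho> k)" for k
    using ent[of _ k] by (intro onb_eqI[OF e]) (simp add: entry_def A_def cinner_onb[OF e])
  then have pa: "perm_op e \<rho> = a" by (rule perm_op_eqI[OF e a])
  have ent': "entry e a = (\<lambda>m k. of_real (A m k))" using ent by (simp add: fun_eq_iff)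
  show "perm_op e \<rho> \<in> doubly_stochastic e"
    unfolding pa doubly_stochastic_iff using a sub row col ent' by (auto simp: sums_iff)
  moreover have "entry e a m k \<in> {0, 1}" for m k
    by (simp add: ent A_def)
  ultimately show "perm_op e \<rho> \<in> partial_permutations e"
    unfolding partial_permutations_iff pa using doubly_stochastic_subset by blast
qed

text \<open>Each column has exactly one entry 1, which defines \<open>\<rho>\<close>. Row sums at
  most 1 make \<open>\<rho>\<close> injective, and nonzero row sums make it surjective.\<close>

lemma perm_op_of_stochastic_01:
  fixes e :: "nat \<Rightarrow> 'a::complex_hilbert"
  assumes e: "orthonormal_basis e" and a: "a \<in> bounded_ops" and A: "substochastic A"
    and row: "\<And>m. suminf (A m) = 1" and col: "\<And>k. (\<Sum>m. A m k) = 1"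
    and ent: "entry e a = (\<lambda>m k. of_real (A m k))" and A01: "\<And>m k. A m k \<in> {0, 1}"
  shows "a \<in> perm_op e ` {\<rho>. bij \<rho>}"
proof -
  have "\<exists>m. A m k = 1" for k
  proof (rule ccontr)
    assume "\<nexists>m. A m k = 1"
    then have "A m k = 0" for m using A01[of m k] by auto
    then show False using col[of k] by simp
  qed
  then obtain \<rho> where \<rho>: "A (\<rho> k) k = 1" for k by metis
  have \<rho>_eq: "m = \<rho> k" if "A m k = 1" for m k
    using substochastic_row_add[OF substochastic_transpose[OF A], of m "\<rho> k" k] \<rho>[of k] that by force
  have "inj \<rho>"
  proof (rule injI, rule ccontr)
    fix k k' assume "\<rho> k = \<rho> k'" "k \<noteq> k'"
    then show False using substochastic_row_add[OF A, of k k' "\<rho> k"] \<rho>[of k] \<rho>[of k'] by simp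
  qed
  moreover have "surj \<rho>"
  proof (rule ccontr)
    assume "\<not> surj \<rho>"
    then obtain m where "m \<notin> range \<rho>" by blast
    then have "A m k = 0" for k using A01[of m k] \<rho>_eq[of m k] by auto
    then have "A m = (\<lambda>_. 0)" by (simp add: fun_eq_iff)
    then show False using row[of m] by simp
  qed
  moreover have "a (e k) = e (\<rho> k)" for k
  proof (rule onb_eqI[OF e])
    fix m
    have "cinner (a (e k)) (e m) = of_real (A m k)"
      using fun_cong[OF fun_cong[OF ent], of m k] by (simp add: entry_def)
    also have "A m k = of_bool (m = \<rho> k)"
    proof (cases "m = \<rho> k")
      case False
      then have "A m k \<noteq> 1" using \<rho>_eq by blast
      with False show ?thesis using A01[of m k] by simp
    qed (simp add: \<rho>)
    finally show "cinner (a (e k)) (e m) = cinner (e (\<rho> k)) (e m)"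
      by (auto simp: cinner_onb[OF e])
  qed
  then have "perm_op e \<rho> = a" by (rule perm_op_eqI[OF e a])
  ultimately show ?thesis by (force simp: bij_def)
qed

theorem theorem2p23:
  fixes e :: "nat \<Rightarrow> 'h::complex_hilbert"
  assumes "orthonormal_basis e"
  shows "wot_exposed (doubly_substochastic e) = partial_permutations e \<and>
         wot_exposed (doubly_stochastic e) = perm_op e ` {\<rho>. bij \<rho>}"
proof (intro conjI equalityI subsetI)
  fix u assume u: "u \<in> wot_exposed (doubly_substochastic e)"
  then have uD: "u \<in> doubly_substochastic e" by (simp add: wot_exposed_def)
  then obtain A where A: "substochastic A" and ent: "entry e u = (\<lambda>m k. of_real (A m k))"
    unfolding doubly_substochastic_iff by blast
  \<comment> \<open>Here \<open>closed\<close> is immediate, since any operator with a substochastic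
    matrix belongs to the set.\<close>
  have "A m k \<in> {0, 1}" for m k
    using ent by (intro wot_exposed_entry[OF assms u _ A])
      (auto simp: doubly_substochastic_iff fun_eq_iff)
  then have "entry e u m k \<in> {0, 1}" for m k
    unfolding ent by (metis insert_iff empty_iff of_real_0 of_real_1)
  with uD show "u \<in> partial_permutations e" by (simp add: partial_permutations_iff)
next
  fix u assume "u \<in> partial_permutations e"
  then show "u \<in> wot_exposed (doubly_substochastic e)"
    by (rule partial_permutation_exposed[OF assms])
next
  fix u assume u: "u \<in> wot_exposed (doubly_stochastic e)"
  then have "u \<in> doubly_stochastic e" by (simp add: wot_exposed_def)
  then obtain A where A: "substochastic A" "\<And>m. suminf (A m) = 1" "\<And>k. (\<Sum>m. A m k) = 1"
    and ent: "entry e u = (\<lambda>m k. of_real (A m k))" and uB: "u \<in> bounded_ops"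
    unfolding doubly_stochastic_iff by blast
  \<comment> \<open>All sums of \<open>A\<close> equal 1, so the deficits in \<open>closed\<close>
    are 0 and the perturbed sums remain equal to 1.\<close>
  have "A m k \<in> {0, 1}" for m k
    using ent by (intro wot_exposed_entry[OF assms u _ A(1)])
      (auto simp: doubly_stochastic_iff fun_eq_iff A)
  then show "u \<in> perm_op e ` {\<rho>. bij \<rho>}"
    by (rule perm_op_of_stochastic_01[OF assms uB A ent])
next
  fix u assume "u \<in> perm_op e ` {\<rho>. bij \<rho>}"
  then obtain \<rho> where \<rho>: "bij \<rho>" and u: "u = perm_op e \<rho>" by blast
  show "u \<in> wot_exposed (doubly_stochastic e)"
    unfolding u using perm_op_doubly_stochastic[OF assms \<rho>]
    by (intro wot_exposed_subset[OF partial_permutation_exposed[OF assms] doubly_stochastic_subset])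
qed

end
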